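(* Let $d,n\geq1$ and let $C\in\mathbb{R}^{dn\times dn}$ be real symmetric positive semidefinite with $d\times d$ blocks $C_{ij}$. Let $X_1,\dots,X_n\in\mathbb{R}^{d\times nd}$ be any matrices with $X_iX_i^T=I_{d\times d}$ for all $i$. Let $R\in\mathbb{R}^{nd\times d}$ have i.i.d. real $\mathcal{N}(0,\frac1d)$ entries and let $V_i=\mathcal{P}(X_iR)\in\mathcal{O}_d$. Then \[ \mathbb{E} \left[ \sum_{i=1}^n\sum_{j=1}^n\operatorname{tr}\left(C_{ij}^TV_iV_j^T\right) \right] \geq \alpha_{\mathbb{R}}(d)^2 \sum_{i=1}^n\sum_{j=1}^n\operatorname{tr}\left(C_{ij}^TX_iX_j^T\right). \] Analogously, let $C\in\mathbb{C}^{dn\times dn}$ be Hermitian positive semidefinite, let $Y_1,\dots,Y_n\in\mathbb{C}^{d\times nd}$ satisfy $Y_iY_i^H=I_{d\times d}$, let $R\in\mathbb{C}^{nd\times d}$ have i.i.d. complex $\mathcal{N}(0,\frac1d)$ entries and let $W_i=\mathcal{P}(Y_iR)\in\mathcal{U}_d$. Then \[ \mathbb{E} \left[ \sum_{i=1}^n\sum_{j=1}^n\operatorname{tr}\left(C_{ij}^HW_iW_j^H\right) \right] \geq \alpha_{\mathbb{C}}(d)^2 \sum_{i=1}^n\sum_{j=1}^n\operatorname{tr}\left(C_{ij}^HY_iY_j^H\right). \]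
   Context: $\mathcal{O}_d$ is the group of real $d\times d$ orthogonal matrices and $\mathcal{U}_d$ the group of complex $d\times d$ unitary matrices. For a real $d\times d$ matrix $X$, $\mathcal{P}(X)=\operatorname{argmin}_{Z\in\mathcal{O}_d}\|Z-X\|_F$; for a complex $d\times d$ matrix $Y$, $\mathcal{P}(Y)=\operatorname{argmin}_{Z\in\mathcal{U}_d}\|Z-Y\|_F$. A complex Gaussian $\mathcal{N}(0,\frac1d)$ entry is circularly symmetric with $\mathbb{E}|z|^2=\frac1d$. With $G_{\mathbb{R}}$ (resp. $G_{\mathbb{C}}$) a $d\times d$ matrix of i.i.d. real (resp. complex) $\mathcal{N}(0,d^{-1})$ entries, $\alpha_{\mathbb{K}}(d)=\mathbb{E}\left[\frac1d\sum_{j=1}^d\sigma_j(G_{\mathbb{K}})\right]$ for $\mathbb{K}\in\{\mathbb{R},\mathbb{C}\}$, where $\sigma_j$ is the $j$-th singular value. *)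

theory Defs
  imports "HOL-Probability.Probability" "HOL-Library.Multiset" "HOL-Library.Complex_Order"
begin

definition cnj_transpose :: "complex^'n^'m \<Rightarrow> complex^'m^'n" where
  "cnj_transpose A = (\<chi> i j. cnj (A $ j $ i))"

definition unitary_matrix :: "complex^'n^'n \<Rightarrow> bool" where
  "unitary_matrix U \<longleftrightarrow> cnj_transpose U ** U = mat 1 \<and> U ** cnj_transpose U = mat 1"

definition diag_mat :: "'a::zero^'n \<Rightarrow> 'a^'n^'n" where
  "diag_mat s = (\<chi> i j. if i = j then s $ i else 0)"

text \<open>Nearest orthogonal / unitary matrix in Frobenius norm (the norm on nested
  vectors is the Frobenius norm). The argmin is unique for nonsingular inputs;
  on the (null) set of singular inputs some minimiser is chosen.\<close>
definition proj_O :: "real^'d^'d \<Rightarrow> real^'d^'d" where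
  "proj_O X = (SOME Z. orthogonal_matrix Z \<and>
      (\<forall>W. orthogonal_matrix W \<longrightarrow> norm (Z - X) \<le> norm (W - X)))"

definition proj_U :: "complex^'d^'d \<Rightarrow> complex^'d^'d" where
  "proj_U Y = (SOME Z. unitary_matrix Z \<and>
      (\<forall>W. unitary_matrix W \<longrightarrow> norm (Z - Y) \<le> norm (W - Y)))"

definition sing_vals_R :: "real^'d^'d \<Rightarrow> real multiset" where
  "sing_vals_R G = (THE M. \<exists>U V s. orthogonal_matrix U \<and> orthogonal_matrix V \<and>
      (\<forall>i. 0 \<le> s $ i) \<and> G = U ** diag_mat s ** transpose V \<and>
      M = image_mset (\<lambda>i. s $ i) (mset_set UNIV))"

definition sing_vals_C :: "complex^'d^'d \<Rightarrow> real multiset" where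
  "sing_vals_C G = (THE M. \<exists>U V s. unitary_matrix U \<and> unitary_matrix V \<and>
      (\<forall>i. 0 \<le> s $ i) \<and> G = U ** diag_mat (\<chi> i. complex_of_real (s $ i)) ** cnj_transpose V \<and>
      M = image_mset (\<lambda>i. s $ i) (mset_set UNIV))"

definition gauss_R :: "real \<Rightarrow> ('i::finite \<Rightarrow> real) measure" where
  "gauss_R var = PiM UNIV (\<lambda>_. density lborel (normal_density 0 (sqrt var)))"

definition rmat :: "('m \<times> 'd \<Rightarrow> real) \<Rightarrow> real^'d^'m" where
  "rmat g = (\<chi> k a. g (k, a))"

text \<open>Circularly symmetric complex Gaussian with E|z|^2 = var:
  real and imaginary parts independent N(0, var/2).\<close>
definition cmat :: "('m \<times> 'd \<times> bool \<Rightarrow> real) \<Rightarrow> complex^'d^'m" where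
  "cmat g = (\<chi> k a. Complex (g (k, a, True)) (g (k, a, False)))"

definition alpha_R :: "'d::finite itself \<Rightarrow> real" where
  "alpha_R _ = (\<integral>g. (1 / real CARD('d)) * sum_mset (sing_vals_R (rmat g :: real^'d^'d))
      \<partial>completion (gauss_R (1 / real CARD('d))))"

definition alpha_C :: "'d::finite itself \<Rightarrow> real" where
  "alpha_C _ = (\<integral>g. (1 / real CARD('d)) * sum_mset (sing_vals_C (cmat g :: complex^'d^'d))
      \<partial>completion (gauss_R (1 / (2 * real CARD('d)))))"

definition block :: "'a^('n::finite \<times> 'd::finite)^('n \<times> 'd) \<Rightarrow> 'n \<Rightarrow> 'n \<Rightarrow> 'a^'d^'d" where
  "block C i j = (\<chi> a b. C $ (i, a) $ (j, b))"

end

theory Submission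
  imports Defs
begin

text \<open>
  Write \<open>Z\<^sub>i = X\<^sub>i R\<close> and \<open>V\<^sub>i = P(Z\<^sub>i)\<close>. The heart of the proof is the identity
  \<open>E[V\<^sub>i R\<^sup>*] = \<alpha> X\<^sub>i\<close>. The law of \<open>R\<close> is invariant under the reflection \<open>2 X\<^sub>i\<^sup>*X\<^sub>i - I\<close>, which fixes
  \<open>Z\<^sub>i\<close>; this gives \<open>E[V\<^sub>i R\<^sup>*] = E[P(G) G\<^sup>*] X\<^sub>i\<close> with \<open>G = Z\<^sub>i\<close> a square Gaussian matrix. As
  \<open>P(UG) = U P(G)\<close> for unitary \<open>U\<close>, the matrix \<open>E[P(G) G\<^sup>*]\<close> commutes with every unitary matrix, hence is
  scalar, and its trace is the expected sum of the singular values of \<open>G\<close>. Together with \<open>E[R R\<^sup>*] = I\<close>,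
  expanding \<open>0 \<le> E \<Sum>\<^sub>i\<^sub>j tr(C\<^sub>i\<^sub>j\<^sup>* (V\<^sub>i - \<alpha> Z\<^sub>i) (V\<^sub>j - \<alpha> Z\<^sub>j)\<^sup>*)\<close> yields the inequality.
\<close>

section \<open>Gaussian measures on Euclidean spaces\<close>

text \<open>Subtracting \<open>\<alpha> Z\<close> is a least-squares choice: the identity for
  \<open>E[V R^*]\<close>, with \<open>E[R R^*] = I\<close>, says that each residual
  \<open>V_i - \<alpha> Z_i\<close> is uncorrelated with \<open>R\<close>. The mixed terms and the
  square of \<open>\<alpha> Z\<close> therefore all contribute the same multiple \<alpha>^2 of the
  objective, and the asserted difference is what survives. The normalisation comes from
  \<open>E[R R^*] = I\<close>: with d columns, E|z|^2 must be 1/d. Since \<open>gaussian v\<close>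
  counts variance per real coordinate, this is v = 1/d over the reals and v = 1/(2d) over the
  complex numbers. The main obstacle is measurability. A nearest matrix is an arbitrary choice at
  singular inputs, so the integrands are only controlled almost everywhere. The argument runs on a
  measurable substitute \<open>polar\<close>, and the integrals over completed measures are reduced
  to it because singular matrices form a null set. A reflection replaces conditioning on
  \<open>XR\<close>: nothing beyond invariance of the Gaussian law under linear isometries enters,
  and that follows from a radial density and the invariance of Lebesgue measure.\<close>

lemma integral_completion_AE:
  fixes f :: "'a \<Rightarrow> 'b::{banach,second_countable_topology}"
  assumes "f0 \<in> borel_measurable M" and "AE x in M. f x = f0 x"
  shows "integral\<^sup>L (completion M) f = integral\<^sup>L M f0"
proof -
  have ae: "AE x in completion M. f x = f0 x"
    using assms(2) by (rule AE_completion)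
  have m: "f0 \<in> borel_measurable (completion M)"
    using assms(1) by (rule measurable_completion)
  \<comment> \<open>Measurability of \<open>f\<close> has to be earned: each preimage under
    \<open>f\<close> differs from the one under \<open>f0\<close> by a null set, and a complete
    measure makes such a set measurable.\<close>
  have "f \<in> borel_measurable (completion M)"
  proof (rule measurableI)
    fix A :: "'b set" assume A: "A \<in> sets borel"
    have s: "{x \<in> space (completion M). f0 x \<in> A} \<in> sets (completion M)"
      using m A by measurable
    have "AE x in completion M. x \<in> {x \<in> space (completion M). f0 x \<in> A} \<longleftrightarrow>
        x \<in> {x \<in> space (completion M). f x \<in> A}"
      using ae by eventually_elim simp
    then have "{x \<in> space (completion M). f x \<in> A} \<in> sets (completion M)"
      using s by (rule completion.in_sets_AE) simp
    then show "f -` A \<inter> space (completion M) \<in> sets (completion M)"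
      by (simp add: vimage_def Int_def conj_commute)
  qed simp
  then have "integral\<^sup>L (completion M) f = integral\<^sup>L (completion M) f0"
    using m ae by (intro integral_cong_AE)
  with assms(1) show ?thesis by (simp add: integral_completion)
qed

text \<open>The argument for uniqueness of translation-invariant measures: the image measure
  \<open>\<mu>\<close> is translation invariant and gives the unit ball B its Lebesgue measure,
  since the preimage of B under \<open>T\<close> is B. Integrating 1_B(y) 1_A(x + y) in both orders
  gives \<mu>(A) |B| = |A| |B|, and |B| is positive and finite.\<close>

lemma lborel_distr_orthogonal:
  fixes T :: "'a::euclidean_space \<Rightarrow> 'a"
  assumes T: "linear T" and iso: "\<And>x. norm (T x) = norm x"
  shows "distr lborel borel T = lborel"
proof -
  define \<mu> where "\<mu> = distr lborel borel T"
  have bl: "bounded_linear T" using T linear_conv_bounded_linear by blast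
  have cT[measurable]: "T \<in> borel_measurable borel"
    using bl by (intro borel_measurable_continuous_onI linear_continuous_on)
  have inj: "inj T"
    by (simp add: linear_injective_0[OF T]) (metis iso norm_eq_zero)
  then have surj: "surj T"
    using T linear_injective_imp_surjective by blast
  have sets[measurable_cong, simp]: "sets \<mu> = sets borel" by (simp add: \<mu>_def)
  have space[simp]: "space \<mu> = UNIV" by (simp add: \<mu>_def)
  have shift: "distr \<mu> borel ((+) c) = \<mu>" for c
  proof -
    obtain b where b: "c = T b" using surj by blast
    have "distr \<mu> borel ((+) c) = distr lborel borel (\<lambda>x. T (b + x))"
      unfolding \<mu>_def using T by (subst distr_distr) (auto simp: comp_def b linear_add)
    also have "\<dots> = distr (distr lborel borel ((+) b)) borel T"
      by (subst distr_distr) (auto simp: comp_def)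
    finally show ?thesis by (simp add: lborel_distr_plus \<mu>_def)
  qed
  have minv[measurable]: "inv T \<in> borel_measurable borel"
    using T inj by (intro borel_measurable_continuous_onI linear_continuous_on)
      (metis linear_conv_bounded_linear inj_linear_imp_inv_linear)
  have inv: "distr \<mu> borel (inv T) = lborel"
    unfolding \<mu>_def using inj by (subst distr_distr) (auto simp: comp_def intro!: distr_id2)
  let ?B = "ball 0 1 :: 'a set"
  have ball: "emeasure \<mu> (ball y 1) = emeasure lborel ?B" for y
  proof -
    have "emeasure \<mu> (ball y 1) = emeasure (distr \<mu> borel ((+) y)) (ball y 1)"
      by (simp add: shift)
    also have "\<dots> = emeasure \<mu> ((+) y -` ball y 1)"
      by (subst emeasure_distr) auto
    also have "(+) y -` ball y 1 = ?B" by (auto simp: dist_norm)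
    also have "emeasure \<mu> ?B = emeasure lborel (T -` ?B)"
      by (simp add: \<mu>_def emeasure_distr)
    also have "T -` ?B = ?B" by (auto simp: iso)
    finally show ?thesis .
  qed
  \<comment> \<open>Fubini needs a sigma-finite \<open>\<mu>\<close>; this is inherited from
    \<open>lborel\<close>, the image of \<open>\<mu>\<close> under \<open>inv T\<close>.\<close>
  interpret \<mu>: sigma_finite_measure \<mu>
    by (rule sigma_finite_measure_distr[of _ borel "inv T"])
      (simp_all add: inv lborel.sigma_finite_measure_axioms measurable_cong_sets[OF sets refl])
  interpret P: pair_sigma_finite lborel \<mu> ..
  let ?I = "\<lambda>A x. indicator A x :: ennreal"
  have "\<mu> = lborel"
  proof (rule measure_eqI)
    fix A assume "A \<in> sets \<mu>"
    then have A[measurable]: "A \<in> sets borel" by simp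
    have [measurable]: "?I A \<in> borel_measurable borel" "?I ?B \<in> borel_measurable borel"
      by (simp_all add: borel_measurable_indicator borel_open)
    have "emeasure \<mu> A * emeasure lborel ?B = (\<integral>\<^sup>+y. ?I ?B y * emeasure \<mu> A \<partial>lborel)"
      by (subst nn_integral_multc) (auto simp: mult.commute)
    \<comment> \<open>Invariance of \<open>\<mu>\<close> under translation by \<open>y\<close>
      brings in \<open>y + x\<close>; after the exchange of integrals, invariance of
      \<open>lborel\<close> under translation by \<open>- x\<close> moves the shift onto the
      ball.\<close>
    also have "\<dots> = (\<integral>\<^sup>+y. (\<integral>\<^sup>+x. ?I ?B y * ?I A x \<partial>(distr \<mu> borel ((+) y))) \<partial>lborel)"
      by (simp add: shift nn_integral_cmult)
    also have "\<dots> = (\<integral>\<^sup>+y. (\<integral>\<^sup>+x. ?I ?B y * ?I A (y + x) \<partial>\<mu>) \<partial>lborel)"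
      by (simp add: nn_integral_distr)
    also have "\<dots> = (\<integral>\<^sup>+x. (\<integral>\<^sup>+y. ?I ?B y * ?I A (y + x) \<partial>lborel) \<partial>\<mu>)"
      by (rule P.Fubini'[symmetric]) measurable
    also have "\<dots> = (\<integral>\<^sup>+x. (\<integral>\<^sup>+y. ?I ?B y * ?I A (y + x) \<partial>(distr lborel borel ((+) (- x)))) \<partial>\<mu>)"
      by (simp add: lborel_distr_plus)
    also have "\<dots> = (\<integral>\<^sup>+x. (\<integral>\<^sup>+y. ?I ?B (y - x) * ?I A y \<partial>lborel) \<partial>\<mu>)"
      by (intro nn_integral_cong, subst nn_integral_distr) auto
    also have "\<dots> = (\<integral>\<^sup>+y. (\<integral>\<^sup>+x. ?I ?B (y - x) * ?I A y \<partial>\<mu>) \<partial>lborel)"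
      by (rule P.Fubini') measurable
    also have "\<dots> = (\<integral>\<^sup>+y. (\<integral>\<^sup>+x. ?I A y * ?I (ball y 1) x \<partial>\<mu>) \<partial>lborel)"
      by (intro nn_integral_cong) (auto simp: indicator_def dist_norm norm_minus_commute)
    also have "\<dots> = emeasure lborel A * emeasure lborel ?B"
      by (subst nn_integral_cmult) (auto simp: ball nn_integral_multc borel_open intro!: borel_measurable_indicator)
    finally have eq: "emeasure \<mu> A * emeasure lborel ?B = emeasure lborel A * emeasure lborel ?B" .
    have "emeasure lborel ?B \<noteq> 0" "emeasure lborel ?B \<noteq> \<infinity>"
      using emeasure_lborel_ball_finite[of "0::'a" 1] content_ball_pos[of 1 "0::'a"]
      by (auto simp: measure_def)
    then show "emeasure \<mu> A = emeasure lborel A"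
      using eq by (simp add: mult.commute[of _ "emeasure lborel ?B"] ennreal_mult_cancel_left)
  qed simp
  then show ?thesis by (simp add: \<mu>_def)
qed


text \<open>The law N(0, v I), with \<open>v\<close> the variance of each real coordinate. Being
  radial, the density needs no coordinates for invariance under isometries. A complex entry has
  E|z|^2 = 2v.\<close>

definition gaussian :: "real \<Rightarrow> 'e::euclidean_space measure" where
  "gaussian v = density lborel
     (\<lambda>x. ennreal ((1 / sqrt (2 * pi * v)) ^ DIM('e) * exp (- (norm x)\<^sup>2 / (2 * v))))"

lemma sets_gaussian [measurable_cong, simp]: "sets (gaussian v) = sets borel"
  and space_gaussian [simp]: "space (gaussian v) = UNIV"
  by (simp_all add: gaussian_def)

text \<open>The index set is kept apart from \<open>Basis\<close> so that matrix positions, with or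
  without a flag for real and imaginary part, can serve as coordinates. Boxes determine
  \<open>lborel\<close>, and their preimages are products of intervals.\<close>

lemma distr_PiM_lborel_Basis:
  fixes b :: "'i \<Rightarrow> 'e::euclidean_space"
  assumes I: "finite I" and b: "bij_betw b I Basis"
  shows "distr (PiM I (\<lambda>_. lborel)) borel (\<lambda>g. \<Sum>i\<in>I. g i *\<^sub>R b i) = lborel"
    (is "distr ?P borel ?\<phi> = _")
proof (rule lborel_eqI[symmetric])
  interpret product_sigma_finite "\<lambda>_::'i. lborel :: real measure" ..
  have inner: "?\<phi> g \<bullet> b j = g j" if "j \<in> I" for g j
  proof -
    have "?\<phi> g \<bullet> b j = (\<Sum>i\<in>I. g i * (if i = j then 1 else 0))"
      unfolding inner_sum_left inner_scaleR_left
    proof (rule sum.cong)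
      fix i assume "i \<in> I"
      then have "b i \<in> Basis" "b j \<in> Basis" "b i = b j \<longleftrightarrow> i = j"
        using b that by (auto simp: bij_betw_def inj_on_eq_iff)
      then show "g i * (b i \<bullet> b j) = g i * (if i = j then 1 else 0)"
        by (simp add: inner_Basis)
    qed simp
    with I that show ?thesis by (simp add: if_distrib cong: if_cong)
  qed
  have bI: "b ` I = Basis" using b by (simp add: bij_betw_def)
  fix l u :: 'e
  assume lu: "\<And>x. x \<in> Basis \<Longrightarrow> l \<bullet> x \<le> u \<bullet> x"
  have "?\<phi> -` box l u \<inter> space ?P = Pi\<^sub>E I (\<lambda>i. {l \<bullet> b i<..<u \<bullet> b i})"
    by (auto simp: mem_box space_PiM PiE_iff inner bI[symmetric] simp del: greaterThanLessThan_iff)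
       (auto simp: inner)
  then have "emeasure (distr ?P borel ?\<phi>) (box l u) = emeasure ?P (Pi\<^sub>E I (\<lambda>i. {l \<bullet> b i<..<u \<bullet> b i}))"
    by (subst emeasure_distr) auto
  also have "\<dots> = (\<Prod>i\<in>I. ennreal ((u - l) \<bullet> b i))"
    using lu bI I by (subst emeasure_PiM) (auto intro!: prod.cong emeasure_lborel_Ioo simp: inner_diff_left)
  also have "\<dots> = (\<Prod>i\<in>I. (u - l) \<bullet> b i)"
    using lu bI by (subst prod_ennreal) (auto simp: inner_diff_left)
  also have "(\<Prod>i\<in>I. (u - l) \<bullet> b i) = (\<Prod>x\<in>Basis. (u - l) \<bullet> x)"
    by (rule prod.reindex_bij_betw[OF b])
  finally show "emeasure (distr ?P borel ?\<phi>) (box l u) = (\<Prod>x\<in>Basis. (u - l) \<bullet> x)" .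
qed simp

lemma PiM_density_lborel:
  fixes f :: "real \<Rightarrow> ennreal"
  assumes I: "finite I" and [measurable]: "f \<in> borel_measurable borel"
    and sf: "sigma_finite_measure (density lborel f)"
  shows "PiM I (\<lambda>_. density lborel f) = density (PiM I (\<lambda>_. lborel)) (\<lambda>x. \<Prod>i\<in>I. f (x i))"
proof -
  interpret L: product_sigma_finite "\<lambda>_. lborel :: real measure" ..
  interpret D: product_sigma_finite "\<lambda>_. density lborel f"
    using sf by (simp add: product_sigma_finite_def)
  show ?thesis
  proof (rule D.PiM_eqI[symmetric])
    show "sets (density (PiM I (\<lambda>_. lborel)) (\<lambda>x. \<Prod>i\<in>I. f (x i))) = sets (PiM I (\<lambda>_. density lborel f))"
      by (simp cong: sets_PiM_cong)
    fix A :: "'a \<Rightarrow> real set" assume A: "\<And>i. i \<in> I \<Longrightarrow> A i \<in> sets (density lborel f)"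
    have "emeasure (density (PiM I (\<lambda>_. lborel)) (\<lambda>x. \<Prod>i\<in>I. f (x i))) (Pi\<^sub>E I A)
        = (\<integral>\<^sup>+x. (\<Prod>i\<in>I. f (x i)) * indicator (Pi\<^sub>E I A) x \<partial>PiM I (\<lambda>_. lborel))"
      using A I by (subst emeasure_density) (auto intro!: sets_PiM_I_finite)
    also have "\<dots> = (\<integral>\<^sup>+x. (\<Prod>i\<in>I. f (x i) * indicator (A i) (x i)) \<partial>PiM I (\<lambda>_. lborel))"
      using I by (intro nn_integral_cong)
        (auto simp: prod.distrib indicator_def space_PiM PiE_iff prod_eq_1_iff)
    also have "\<dots> = (\<Prod>i\<in>I. \<integral>\<^sup>+x. f x * indicator (A i) x \<partial>lborel)"
      using A I by (intro L.product_nn_integral_prod) auto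
    also have "\<dots> = (\<Prod>i\<in>I. emeasure (density lborel f) (A i))"
      using A by (intro prod.cong) (auto simp: emeasure_density)
    finally show "emeasure (density (PiM I (\<lambda>_. lborel)) (\<lambda>x. \<Prod>i\<in>I. f (x i))) (Pi\<^sub>E I A)
        = (\<Prod>i\<in>I. emeasure (density lborel f) (A i))" .
  qed (use I in auto)
qed

lemma sigma_finite_normal:
  assumes "\<sigma> > 0" shows "sigma_finite_measure (density lborel (normal_density \<mu> \<sigma>))"
proof -
  interpret prob_space "density lborel (normal_density \<mu> \<sigma>)"
    using assms by (rule prob_space_normal_density)
  show ?thesis ..
qed

text \<open>By orthonormality the squares of the coordinates add up to the squared norm, so the
  product of the one-dimensional densities is the radial density of
  \<open>gaussian v\<close>.\<close>

lemma distr_PiM_normal_Basis: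
  fixes b :: "'i \<Rightarrow> 'e::euclidean_space"
  assumes v: "v > 0" and I: "finite I" and b: "bij_betw b I Basis"
  shows "distr (PiM I (\<lambda>_. density lborel (normal_density 0 (sqrt v)))) borel
      (\<lambda>g. \<Sum>i\<in>I. g i *\<^sub>R b i) = gaussian v"
    (is "distr _ borel ?\<phi> = _")
proof -
  let ?h = "\<lambda>x::'e. ennreal ((1 / sqrt (2 * pi * v)) ^ DIM('e) * exp (- (norm x)\<^sup>2 / (2 * v)))"
  have norm: "(norm (?\<phi> g))\<^sup>2 = (\<Sum>i\<in>I. (g i)\<^sup>2)" for g
  proof -
    have "pairwise orthogonal (b ` I)"
      using b by (auto simp: bij_betw_def pairwise_def orthogonal_def inner_Basis)
    then have "(norm (?\<phi> g))\<^sup>2 = (\<Sum>i\<in>I. (norm (g i *\<^sub>R b i))\<^sup>2)"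
      using b I by (intro norm_sum_Pythagorean)
       (auto simp: bij_betw_def pairwise_def orthogonal_def inner_Basis inj_on_eq_iff)
    also have "\<dots> = (\<Sum>i\<in>I. (g i)\<^sup>2)"
      using b by (intro sum.cong) (auto simp: norm_Basis power_mult_distrib dest: bij_betwE)
    finally show ?thesis .
  qed
  have card: "card I = DIM('e)" using b by (rule bij_betw_same_card)
  have dens: "(\<Prod>i\<in>I. ennreal (normal_density 0 (sqrt v) (g i))) = ?h (?\<phi> g)" for g
    using v I by (subst prod_ennreal)
      (auto simp: normal_density_def prod.distrib exp_sum[symmetric] norm card power_divide
        sum_negf sum_divide_distrib prod_dividef)
  have "PiM I (\<lambda>_. density lborel (normal_density 0 (sqrt v))) = density (PiM I (\<lambda>_. lborel)) (\<lambda>g. ?h (?\<phi> g))"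
    using v I by (subst PiM_density_lborel) (auto simp: dens sigma_finite_normal)
  then have "distr (PiM I (\<lambda>_. density lborel (normal_density 0 (sqrt v)))) borel ?\<phi>
      = density (distr (PiM I (\<lambda>_. lborel)) borel ?\<phi>) ?h"
    by (subst density_distr) auto
  also have "\<dots> = gaussian v"
    by (simp add: distr_PiM_lborel_Basis[OF I b] gaussian_def)
  finally show ?thesis .
qed

lemma prob_space_gaussian:
  assumes "v > 0" shows "prob_space (gaussian v :: 'e::euclidean_space measure)"
proof -
  interpret product_prob_space "\<lambda>_::'e. density lborel (normal_density 0 (sqrt v))" "Basis :: 'e set"
    using assms by (intro product_prob_space.intro product_prob_space_axioms.intro product_sigma_finite.intro)
     (auto intro: sigma_finite_normal prob_space_normal_density)
  show "prob_space (gaussian v :: 'e measure)"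
    unfolding distr_PiM_normal_Basis[OF assms finite_Basis bij_betw_id, symmetric]
    by (intro prob_space_distr) auto
qed

text \<open>Squared norms add over pairs, so the densities multiply. This allows an independent
  auxiliary Gaussian vector to be adjoined, which turns a coisometry into part of an
  isometry.\<close>

lemma gaussian_pair:
  assumes "v > 0"
  shows "gaussian v \<Otimes>\<^sub>M gaussian v = (gaussian v :: ('e::euclidean_space \<times> 'f::euclidean_space) measure)"
proof -
  interpret F: prob_space "gaussian v :: 'f measure" using assms by (rule prob_space_gaussian)
  have "gaussian v \<Otimes>\<^sub>M gaussian v = density (lborel \<Otimes>\<^sub>M lborel) (\<lambda>(x::'e, y::'f).
     ennreal ((1 / sqrt (2 * pi * v)) ^ DIM('e) * exp (- (norm x)\<^sup>2 / (2 * v))) *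
     ennreal ((1 / sqrt (2 * pi * v)) ^ DIM('f) * exp (- (norm y)\<^sup>2 / (2 * v))))"
    using F.sigma_finite_measure_axioms unfolding gaussian_def
    by (intro pair_measure_density lborel.sigma_finite_measure_axioms) auto
  also have "\<dots> = gaussian v"
    unfolding gaussian_def lborel_prod
  proof (intro arg_cong[where f="density lborel"] ext, clarify)
    fix x :: 'e and y :: 'f
    let ?a = "1 / sqrt (2 * pi * v)"
    have "?a \<ge> 0" using assms by simp
    moreover have "exp (- (norm (x, y))\<^sup>2 / (2 * v)) = exp (- (norm x)\<^sup>2 / (2 * v)) * exp (- (norm y)\<^sup>2 / (2 * v))"
      by (simp add: norm_Pair exp_add[symmetric] add_divide_distrib diff_divide_distrib)
    ultimately show "ennreal (?a ^ DIM('e) * exp (- (norm x)\<^sup>2 / (2 * v))) *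
        ennreal (?a ^ DIM('f) * exp (- (norm y)\<^sup>2 / (2 * v))) =
        ennreal (?a ^ DIM('e \<times> 'f) * exp (- (norm (x, y))\<^sup>2 / (2 * v)))"
      by (simp only: ennreal_mult[symmetric] DIM_prod power_add zero_le_power mult_nonneg_nonneg exp_ge_zero mult_ac)
  qed
  finally show ?thesis .
qed

lemma gaussian_distr_orthogonal:
  fixes T :: "'e::euclidean_space \<Rightarrow> 'e"
  assumes "linear T" and "\<And>x. norm (T x) = norm x"
  shows "distr (gaussian v) borel T = gaussian v"
proof -
  have [measurable]: "T \<in> borel_measurable borel"
    using assms(1) by (intro borel_measurable_continuous_onI linear_continuous_on)
      (simp add: linear_conv_bounded_linear)
  show ?thesis
    unfolding gaussian_def
    \<comment> \<open>The \<open>lborel\<close> on the right-hand side is replaced by its image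
      under \<open>T\<close>; pulling the density back through \<open>T\<close> does not change it,
      because \<open>T\<close> preserves norms.\<close>
    by (subst (2) lborel_distr_orthogonal[OF assms, symmetric], subst density_distr) (auto simp: assms)
qed

text \<open>The map \<open>(x, y) \<mapsto> (x - L\<^sup>*Lx + L\<^sup>*y, Lx)\<close> on the product space is orthogonal, so \<open>Lx\<close> has the
  law of \<open>y\<close>.\<close>

lemma gaussian_distr_coisometry:
  fixes L :: "'e::euclidean_space \<Rightarrow> 'f::euclidean_space"
  assumes v: "v > 0" and L: "linear L" and L': "linear L'"
    and adj: "\<And>x y. L x \<bullet> y = x \<bullet> L' y" and id: "\<And>y. L (L' y) = y"
  shows "distr (gaussian v) borel L = gaussian v"
proof -
  interpret E: prob_space "gaussian v :: 'e measure" using v by (rule prob_space_gaussian)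
  interpret F: prob_space "gaussian v :: 'f measure" using v by (rule prob_space_gaussian)
  define T where "T = (\<lambda>(x, y). (x - L' (L x) + L' y, L x))"
  have lin: "linear T"
    unfolding T_def by (rule linearI) (auto simp: linear_add[OF L] linear_add[OF L'] linear_scale[OF L]
      linear_scale[OF L'] algebra_simps)
  have adj': "L' y \<bullet> x = y \<bullet> L x" for x y
    using adj[of x y] by (simp add: inner_commute)
  have iso: "norm (T z) = norm z" for z
  proof -
    obtain x y where z: "z = (x, y)" by (cases z)
    \<comment> \<open>\<open>x - L' (L x)\<close> lies in the kernel of \<open>L\<close>, hence is
      orthogonal to \<open>L' y\<close>, and \<open>L'\<close> preserves norms because
      \<open>L (L' y) = y\<close>. The missing \<open>L x \<bullet> L x\<close> is supplied by the
      second component of \<open>T\<close>.\<close>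
    have "(x - L' (L x) + L' y) \<bullet> (x - L' (L x) + L' y) = x \<bullet> x - L x \<bullet> L x + y \<bullet> y"
      by (simp add: inner_add_left inner_add_right inner_diff_left inner_diff_right adj[symmetric]
        adj' id inner_commute[of y "L x"] linear_add[OF L] linear_diff[OF L])
    then show ?thesis
      by (simp add: z T_def norm_eq)
  qed
  have [measurable]: "L \<in> borel_measurable borel"
    using L by (intro borel_measurable_continuous_onI linear_continuous_on)
      (simp add: linear_conv_bounded_linear)
  have [measurable]: "T \<in> borel_measurable borel"
    using lin by (intro borel_measurable_continuous_onI linear_continuous_on)
      (simp add: linear_conv_bounded_linear)
  have "distr (gaussian v) borel L = distr (distr (gaussian v \<Otimes>\<^sub>M (gaussian v :: 'f measure)) (gaussian v) fst) borel L"
    by (subst F.distr_pair_fst) (rule refl)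
  also have "\<dots> = distr (gaussian v) borel (\<lambda>z::'e \<times> 'f. snd (T z))"
    unfolding gaussian_pair[OF v, symmetric]
    by (subst distr_distr) (simp_all add: T_def comp_def case_prod_beta)
  also have "\<dots> = distr (distr (gaussian v) borel T) borel snd"
    by (subst distr_distr) (simp_all add: comp_def borel_measurable_continuous_onI continuous_on_snd)
  also have "\<dots> = distr (gaussian v \<Otimes>\<^sub>M gaussian v :: ('e \<times> 'f) measure) borel snd"
    by (simp add: gaussian_distr_orthogonal[OF lin iso] gaussian_pair[OF v])
  also have "\<dots> = gaussian v"
  proof (rule measure_eqI)
    fix A :: "'f set" assume "A \<in> sets (distr (gaussian v \<Otimes>\<^sub>M gaussian v :: ('e \<times> 'f) measure) borel snd)"
    then have "A \<in> sets borel" by simp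
    moreover have "snd -` A \<inter> space (gaussian v \<Otimes>\<^sub>M gaussian v) = (UNIV :: 'e set) \<times> A"
      by (auto simp: space_pair_measure)
    ultimately show "emeasure (distr (gaussian v \<Otimes>\<^sub>M gaussian v :: ('e \<times> 'f) measure) borel snd) A
        = emeasure (gaussian v) A"
      using E.emeasure_space_1 by (simp add: emeasure_distr F.emeasure_pair_measure_Times)
  qed simp
  finally show ?thesis .
qed

text \<open>Taking the coordinate along a unit vector is a coisometry onto the reals with adjoint
  \<open>r \<mapsto> r u\<close>, so the claim reduces to the one-dimensional normal law.\<close>

lemma gaussian_second_moment:
  fixes u :: "'e::euclidean_space"
  assumes v: "v > 0" and u: "norm u = 1"
  shows "integrable (gaussian v) (\<lambda>x. (x \<bullet> u)\<^sup>2)" and "(\<integral>x. (x \<bullet> u)\<^sup>2 \<partial>gaussian v) = v"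
proof -
  have d: "distr (gaussian v) borel (\<lambda>x. x \<bullet> u) = (gaussian v :: real measure)"
  proof (rule gaussian_distr_coisometry[where L' = "\<lambda>r. r *\<^sub>R u"])
    show "linear (\<lambda>x. x \<bullet> u)" "linear (\<lambda>r. r *\<^sub>R u)"
      by (auto intro!: linearI simp: inner_add_left scaleR_add_left)
    show "(r *\<^sub>R u) \<bullet> u = r" for r using u by (simp add: norm_eq_1)
  qed (use v in simp_all)
  have g: "(gaussian v :: real measure) = density lborel (normal_density 0 (sqrt v))"
    using v unfolding gaussian_def by (intro density_cong) (auto simp: normal_density_def)
  have "integrable (gaussian v :: real measure) (\<lambda>x. x\<^sup>2)"
    unfolding g using integrable_normal_moment[of "sqrt v" 0 2] v
    by (subst integrable_density) auto
  moreover have "(\<integral>x. x\<^sup>2 \<partial>(gaussian v :: real measure)) = v"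
  proof -
    have "(\<integral>x. x\<^sup>2 \<partial>(gaussian v :: real measure)) = (\<integral>x. normal_density 0 (sqrt v) x * x\<^sup>2 \<partial>lborel)"
      unfolding g by (subst integral_density) auto
    also have "\<dots> = v"
      using integral_normal_moment_even[of "sqrt v" 0 1] v by simp
    finally show ?thesis .
  qed
  ultimately show "integrable (gaussian v) (\<lambda>x. (x \<bullet> u)\<^sup>2)" "(\<integral>x. (x \<bullet> u)\<^sup>2 \<partial>gaussian v) = v"
    unfolding d[symmetric] by (simp_all add: integrable_distr_eq integral_distr)
qed

lemma gaussian_norm_square:
  assumes v: "v > 0"
  shows "integrable (gaussian v) (\<lambda>x::'e::euclidean_space. (norm x)\<^sup>2)"
    and "(\<integral>x. (norm (x::'e))\<^sup>2 \<partial>gaussian v) = real DIM('e) * v"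
proof -
  have n: "(norm x)\<^sup>2 = (\<Sum>b\<in>Basis. (x \<bullet> b)\<^sup>2)" for x :: 'e
    unfolding power2_norm_eq_inner by (subst euclidean_inner) (simp add: power2_eq_square)
  show "integrable (gaussian v) (\<lambda>x::'e. (norm x)\<^sup>2)"
    unfolding n using v by (intro Bochner_Integration.integrable_sum gaussian_second_moment) auto
  show "(\<integral>x. (norm (x::'e))\<^sup>2 \<partial>gaussian v) = real DIM('e) * v"
    unfolding n using v
    by (subst Bochner_Integration.integral_sum) (simp_all add: gaussian_second_moment)
qed

lemma gaussian_norm_integrable:
  assumes v: "v > 0"
  shows "integrable (gaussian v) (\<lambda>x::'e::euclidean_space. norm x)"
proof -
  interpret prob_space "gaussian v :: 'e measure" using v by (rule prob_space_gaussian)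
  have i: "integrable (gaussian v) (\<lambda>x::'e. 1 + (norm x)\<^sup>2)"
    using gaussian_norm_square[OF v] by (intro Bochner_Integration.integrable_add) auto
  have t: "t \<le> 1 + t\<^sup>2" for t :: real
    using zero_le_power2[of "t - 1"] zero_le_power2[of t] unfolding power2_diff power_one mult_1_right by linarith
  have "norm (norm x) \<le> norm (1 + (norm x)\<^sup>2)" for x :: 'e
    using t[of "norm x"] by simp
  then show ?thesis
    by (intro Bochner_Integration.integrable_bound[OF i]) simp_all
qed

section \<open>Matrices over a field with conjugation\<close>

lemma matrix_add_rdistrib: "(A + B) ** C = A ** C + B ** (C :: 'a::semiring_1^'n^'m)"
  by (vector matrix_matrix_mult_def sum.distrib[symmetric] distrib_right)

lemma matrix_diff_ldistrib: "A ** (B - C) = A ** B - A ** (C :: 'a::ring_1^'n^'m)"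
  by (vector matrix_matrix_mult_def sum_subtractf[symmetric] right_diff_distrib)

lemma matrix_diff_rdistrib: "(A - B) ** C = A ** C - B ** (C :: 'a::ring_1^'n^'m)"
  by (vector matrix_matrix_mult_def sum_subtractf[symmetric] left_diff_distrib)

lemma matrix_scaleR_left: "(r *\<^sub>R A) ** B = r *\<^sub>R (A ** (B :: 'a::real_algebra_1^'n^'m))"
  by (vector matrix_matrix_mult_def scaleR_sum_right)

lemma matrix_scaleR_right: "A ** (r *\<^sub>R B) = r *\<^sub>R (A ** (B :: 'a::real_algebra_1^'n^'m))"
  by (vector matrix_matrix_mult_def scaleR_sum_right)

lemma continuous_on_matrix_mult [continuous_intros]:
  fixes f :: "'x::topological_space \<Rightarrow> 'a::real_normed_field^'m^'n" and g :: "'x \<Rightarrow> 'a^'k^'m"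
  assumes "continuous_on S f" "continuous_on S g"
  shows "continuous_on S (\<lambda>x. f x ** g x)"
  unfolding matrix_matrix_mult_def using assms by (intro continuous_intros)

lemma continuous_on_trace [continuous_intros]:
  fixes f :: "'x::topological_space \<Rightarrow> 'a::real_normed_field^'n^'n"
  assumes "continuous_on S f"
  shows "continuous_on S (\<lambda>x. trace (f x))"
  unfolding trace_def using assms by (intro continuous_intros)

lemma continuous_on_det [continuous_intros]:
  fixes f :: "'x::topological_space \<Rightarrow> 'a::real_normed_field^'n^'n"
  assumes "continuous_on S f"
  shows "continuous_on S (\<lambda>x. det (f x))"
  unfolding det_def using assms by (intro continuous_intros)

text \<open>The elementary matrix \<open>E_ij\<close> scaled by \<open>x\<close>; test matrices in
  the optimality argument are the identity plus a few of these.\<close>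

definition matrix_unit :: "'m \<Rightarrow> 'n \<Rightarrow> 'a::zero \<Rightarrow> 'a^'n^'m" where
  "matrix_unit i j x = (\<chi> k l. if k = i \<and> l = j then x else 0)"

lemma matrix_unit_mult:
  fixes x :: "'a::semiring_1"
  shows "matrix_unit i j x ** matrix_unit k l y = (if j = k then matrix_unit i l (x * y) else 0)"
proof -
  have "(\<Sum>c\<in>UNIV. (if a = i \<and> c = j then x else 0) * (if c = k \<and> b = l then y else 0)) =
      (\<Sum>c\<in>UNIV. if c = j then if a = i \<and> j = k \<and> b = l then x * y else 0 else 0)" for a b
    by (rule sum.cong) auto
  then show ?thesis
    by (simp add: vec_eq_iff matrix_unit_def matrix_matrix_mult_def)
qed

lemma trace_mult_matrix_unit:
  fixes x :: "'a::semiring_1"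
  shows "trace (B ** matrix_unit i j x) = B $ j $ i * x"
proof -
  have "(B ** matrix_unit i j x) $ k $ k = (if k = j then B $ j $ i * x else 0)" for k
  proof -
    have "(\<Sum>c\<in>UNIV. B $ k $ c * (if c = i \<and> k = j then x else 0)) =
        (\<Sum>c\<in>UNIV. if c = i then if k = j then B $ k $ i * x else 0 else 0)"
      by (rule sum.cong) auto
    then show ?thesis by (simp add: matrix_unit_def matrix_matrix_mult_def)
  qed
  then show ?thesis by (simp add: trace_def)
qed

text \<open>The reals with the identity and the complex numbers with conjugation, treated uniformly.\<close>

locale star_field =
  fixes cj :: "'a::{real_normed_field,euclidean_space} \<Rightarrow> 'a"
  assumes cj_add: "cj (x + y) = cj x + cj y"
    and cj_mult: "cj (x * y) = cj x * cj y"
    and cj_cj [simp]: "cj (cj x) = x"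
    and cj_mult_self: "cj x * x = of_real ((norm x)\<^sup>2)"
begin

lemma cj_0 [simp]: "cj 0 = 0"
  using cj_add[of 0 0] by simp

lemma cj_minus: "cj (- x) = - cj x"
  using cj_add[of x "- x"] by (simp add: eq_neg_iff_add_eq_0 add.commute)

lemma cj_diff: "cj (x - y) = cj x - cj y"
  using cj_add[of x "- y"] by (simp add: cj_minus)

lemma cj_sum: "cj (sum f A) = (\<Sum>x\<in>A. cj (f x))"
  by (induction A rule: infinite_finite_induct) (auto simp: cj_add)

lemma cj_of_real [simp]: "cj (of_real r) = of_real r"
proof (cases "r = 0")
  case False
  then show ?thesis using cj_mult_self[of "of_real r"] by (simp add: power2_eq_square)
qed simp

lemma cj_1 [simp]: "cj 1 = 1"
  using cj_of_real[of 1] by simp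

lemma cj_scaleR: "cj (r *\<^sub>R x) = r *\<^sub>R cj x"
  by (simp add: scaleR_conv_of_real cj_mult)

lemma norm_cj [simp]: "norm (cj x) = norm x"
proof -
  have "(of_real ((norm (cj x))\<^sup>2) :: 'a) = of_real ((norm x)\<^sup>2)"
    unfolding cj_mult_self[symmetric] by (simp add: mult.commute)
  then show ?thesis by (simp only: of_real_eq_iff power2_eq_iff_nonneg norm_ge_zero)
qed

lemma continuous_on_cj [continuous_intros]:
  fixes f :: "'x::metric_space \<Rightarrow> 'a"
  shows "continuous_on S f \<Longrightarrow> continuous_on S (\<lambda>x. cj (f x))"
  unfolding continuous_on_iff dist_norm[of "cj _"] cj_diff[symmetric] norm_cj dist_norm[symmetric] .

definition re :: "'a \<Rightarrow> real" where "re x = x \<bullet> 1"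

text \<open>Polarisation of \<open>cj_mult_self\<close>. It ties the Euclidean inner product to the
  conjugation and so identifies \<open>re\<close> with the usual real part.\<close>

lemma of_real_inner: "of_real (x \<bullet> y) = (cj x * y + cj y * x) / 2"
proof -
  have "(norm (x + y))\<^sup>2 = (norm x)\<^sup>2 + 2 * (x \<bullet> y) + (norm y)\<^sup>2"
    by (simp add: power2_norm_eq_inner inner_add_left inner_add_right inner_commute)
  then have "(of_real ((norm (x + y))\<^sup>2) :: 'a) = of_real ((norm x)\<^sup>2) + 2 * of_real (x \<bullet> y) + of_real ((norm y)\<^sup>2)"
    by simp
  then have "2 * of_real (x \<bullet> y) = cj x * y + cj y * x"
    unfolding cj_mult_self[symmetric] by (simp add: cj_add algebra_simps)
  then show ?thesis by (simp add: field_simps)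
qed

lemma of_real_re: "of_real (re x) = (cj x + x) / 2"
  unfolding re_def of_real_inner by (simp add: add.commute)

lemma inner_eq_re: "x \<bullet> y = re (cj x * y)"
proof -
  have "(of_real (x \<bullet> y) :: 'a) = of_real (re (cj x * y))"
    unfolding of_real_re of_real_inner by (simp add: cj_mult mult.commute add.commute)
  then show ?thesis by (simp only: of_real_eq_iff)
qed

lemma linear_re: "linear re"
  unfolding re_def by (intro linearI) (auto simp: inner_add_left)

lemmas re_add = linear_add[OF linear_re] and re_diff = linear_diff[OF linear_re]
  and re_sum = linear_sum[OF linear_re]
  and re_scaleR = linear_scale[OF linear_re]

lemma re_0 [simp]: "re 0 = 0" by (simp add: re_def)

lemma re_cj [simp]: "re (cj x) = re x"
proof -
  have "(of_real (re (cj x)) :: 'a) = of_real (re x)"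
    by (simp only: of_real_re cj_cj add.commute)
  then show ?thesis by (simp only: of_real_eq_iff)
qed

lemma re_of_real [simp]: "re (of_real r) = r"
proof -
  have "(of_real (re (of_real r)) :: 'a) = of_real r"
    by (simp add: of_real_re)
  then show ?thesis by (simp only: of_real_eq_iff)
qed

lemma re_of_real_mult: "re (of_real r * x) = r * re x"
  using re_scaleR[of r x] by (simp add: scaleR_conv_of_real)

lemma re_le_norm: "re x \<le> norm x"
  using norm_cauchy_schwarz[of x 1] by (simp add: re_def)

text \<open>Equality case of Cauchy-Schwarz against 1: the squared distance from \<open>x\<close> to
  \<open>norm x\<close> is 2 |x|^2 - 2 |x| re x.\<close>

lemma re_eq_normD:
  assumes "re x \<ge> norm x" shows "x = of_real (norm x)"
proof -
  have "re x = norm x" using assms re_le_norm[of x] by simp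
  moreover have "(norm (x - norm x *\<^sub>R 1))\<^sup>2 = (norm x)\<^sup>2 + (norm (norm x *\<^sub>R (1::'a)))\<^sup>2 - 2 * (norm x * re x)"
    unfolding re_def using dot_norm_neg[of x "norm x *\<^sub>R 1"] by simp
  ultimately have "(norm (x - norm x *\<^sub>R 1))\<^sup>2 = 0" by (simp add: power2_eq_square)
  then show ?thesis by (simp add: of_real_def)
qed

lemma cj_eq_selfD: "cj x = x \<Longrightarrow> x = of_real (re x)"
  using of_real_re[of x] by simp

lemma continuous_on_re [continuous_intros]:
  "continuous_on S f \<Longrightarrow> continuous_on S (\<lambda>x. re (f x))"
  unfolding re_def by (intro continuous_intros)

definition cjt :: "'a^'n^'m \<Rightarrow> 'a^'m^'n" where
  "cjt A = (\<chi> i j. cj (A $ j $ i))"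

lemma cjt_cjt [simp]: "cjt (cjt A) = A"
  by (simp add: cjt_def vec_eq_iff)

lemma cjt_mult: "cjt (A ** B) = cjt B ** cjt A"
  by (simp add: cjt_def vec_eq_iff matrix_matrix_mult_def cj_sum cj_mult mult.commute)

lemma cjt_mat_1 [simp]: "cjt (mat 1) = mat 1"
  by (auto simp: cjt_def vec_eq_iff mat_def)

lemma cjt_add: "cjt (A + B) = cjt A + cjt B"
  by (simp add: cjt_def vec_eq_iff cj_add)

lemma cjt_diff: "cjt (A - B) = cjt A - cjt B"
  by (simp add: cjt_def vec_eq_iff cj_diff)

lemma cjt_scaleR: "cjt (r *\<^sub>R A) = r *\<^sub>R cjt A"
  by (simp add: cjt_def vec_eq_iff cj_scaleR)

lemma cjt_matrix_unit: "cjt (matrix_unit i j x) = matrix_unit j i (cj x)"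
  by (auto simp: cjt_def matrix_unit_def vec_eq_iff)

lemma trace_cjt: "trace (cjt A) = cj (trace A)"
  by (simp add: trace_def cjt_def cj_sum)

lemma continuous_on_cjt [continuous_intros]:
  fixes f :: "'x::metric_space \<Rightarrow> 'a^'n^'m"
  shows "continuous_on S f \<Longrightarrow> continuous_on S (\<lambda>x. cjt (f x))"
  unfolding cjt_def by (intro continuous_intros)

text \<open>The Frobenius inner product: through it, nearest-matrix problems become trace
  problems.\<close>

lemma inner_matrix: "A \<bullet> B = re (trace (cjt A ** B))"
  unfolding inner_vec_def trace_def cjt_def matrix_matrix_mult_def
  by (simp add: inner_eq_re re_sum) (rule sum.swap)

lemma inner_matrix_left: "(A ** B) \<bullet> C = B \<bullet> (cjt A ** C)"
  by (simp add: inner_matrix cjt_mult matrix_mul_assoc)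

definition unitary :: "'a^'n^'n \<Rightarrow> bool" where
  "unitary U \<longleftrightarrow> cjt U ** U = mat 1 \<and> U ** cjt U = mat 1"

lemma unitaryI: "cjt U ** U = mat 1 \<Longrightarrow> unitary U"
  by (simp add: unitary_def matrix_left_right_inverse)

lemma unitary_mat_1: "unitary (mat 1)"
  by (simp add: unitary_def)

lemma unitary_cjt: "unitary U \<Longrightarrow> unitary (cjt U)"
  by (simp add: unitary_def)

lemma unitary_mult:
  assumes "unitary U" "unitary V" shows "unitary (U ** V)"
proof (rule unitaryI)
  have "cjt (U ** V) ** (U ** V) = cjt V ** (cjt U ** U) ** V"
    by (simp add: cjt_mult matrix_mul_assoc)
  then show "cjt (U ** V) ** (U ** V) = mat 1" using assms by (simp add: unitary_def)
qed

lemma unitary_norm_square: "unitary (U :: 'a^'d^'d) \<Longrightarrow> (norm U)\<^sup>2 = real CARD('d)"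
  using re_of_real[of "real CARD('d)"] by (simp add: power2_norm_eq_inner inner_matrix unitary_def trace_I)

lemma unitary_entry_le:
  assumes "unitary (U :: 'a^'d^'d)" shows "norm (U $ i $ j) \<le> 1"
proof -
  have "(\<Sum>k\<in>UNIV. cj (U $ k $ j) * U $ k $ j) = (cjt U ** U) $ j $ j"
    by (simp add: matrix_matrix_mult_def cjt_def)
  also have "\<dots> = 1" using assms by (simp add: unitary_def mat_def)
  finally have "of_real (\<Sum>k\<in>UNIV. (norm (U $ k $ j))\<^sup>2) = (1::'a)" by (simp add: cj_mult_self)
  then have "(\<Sum>k\<in>UNIV. (norm (U $ k $ j))\<^sup>2) = 1" by (simp only: of_real_eq_1_iff)
  moreover have "(norm (U $ i $ j))\<^sup>2 \<le> (\<Sum>k\<in>UNIV. (norm (U $ k $ j))\<^sup>2)"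
    by (rule member_le_sum) auto
  ultimately show ?thesis by (simp add: abs_square_le_1)
qed

lemma compact_unitary: "compact {U :: 'a^'d^'d. unitary U}"
proof -
  have "bounded {U :: 'a^'d^'d. unitary U}"
  proof (rule boundedI)
    fix U :: "'a^'d^'d" assume "U \<in> {U. unitary U}"
    then have "norm U = sqrt (real CARD('d))"
      by (intro real_sqrt_unique[symmetric]) (auto simp: unitary_norm_square)
    then show "norm U \<le> sqrt (real CARD('d))" by simp
  qed
  moreover have "closed {U :: 'a^'d^'d. unitary U}"
    unfolding unitary_def by (intro closed_Collect_conj closed_Collect_eq continuous_intros)
  ultimately show ?thesis by (simp add: compact_eq_bounded_closed)
qed

text \<open>First-order optimality, tested on plane rotations and on multiplying one column by a unit scalar.\<close>

lemma trace_maximal_hermitian: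
  fixes B :: "'a^'d^'d"
  assumes max: "\<And>W. unitary W \<Longrightarrow> re (trace (B ** W)) \<le> re (trace B)"
  shows "cjt B = B" and "B $ i $ i = of_real (norm (B $ i $ i))"
proof -
  show diag: "B $ i $ i = of_real (norm (B $ i $ i))" for i
  proof (cases "B $ i $ i = 0")
    case False
    \<comment> \<open>The unit scalar that rotates the diagonal entry onto the nonnegative real
      axis.\<close>
    define p where "p = cj (B $ i $ i) / of_real (norm (B $ i $ i))"
    have p: "cj p * p = 1" using False by (subst cj_mult_self) (simp add: p_def norm_divide)
    have "unitary (mat 1 + matrix_unit i i (p - 1))"
      by (rule unitaryI, simp add: cjt_add cjt_matrix_unit matrix_add_ldistrib matrix_add_rdistrib
        matrix_unit_mult cj_diff) (auto simp: vec_eq_iff matrix_unit_def algebra_simps p[simplified mult.commute[of "cj p"]])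
    from max[OF this] have "re (B $ i $ i * (p - 1)) \<le> 0"
      by (simp add: matrix_add_ldistrib trace_add re_add trace_mult_matrix_unit)
    moreover have "B $ i $ i * p = of_real (norm (B $ i $ i))"
      using False cj_mult_self[of "B $ i $ i"] by (simp add: p_def power2_eq_square mult.commute)
    ultimately have "norm (B $ i $ i) \<le> re (B $ i $ i)"
      by (simp add: right_diff_distrib re_diff)
    then show ?thesis by (rule re_eq_normD)
  qed simp
  have off: "B $ i $ j = cj (B $ j $ i)" if "i \<noteq> j" for i j
  proof (rule ccontr)
    assume neq: "B $ i $ j \<noteq> cj (B $ j $ i)"
    \<comment> \<open>\<open>z\<close> measures the failure of the Hermitian property, and
      \<open>p\<close> is the unit scalar with \<open>z * p = norm z\<close>. The number
      \<open>b\<close> below equals \<open>norm z\<close>, while optimality forces it to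
      vanish.\<close>
    define z where "z = B $ i $ j - cj (B $ j $ i)"
    define p where "p = cj z / of_real (norm z)"
    have z: "z \<noteq> 0" using neq by (simp add: z_def)
    have p: "cj p * p = 1" using z by (subst cj_mult_self) (simp add: p_def norm_divide)
    define a b where "a = re (B $ i $ i + B $ j $ j)" and "b = re (B $ i $ j * p - B $ j $ i * cj p)"
    have key: "(c - 1) * a + s * b \<le> 0" if cs: "c\<^sup>2 + s\<^sup>2 = 1" for c s
    proof -
      define x y where "x = (of_real (c - 1) :: 'a)" and "y = of_real s * p"
      \<comment> \<open>The rotation in the plane of \<open>i\<close> and \<open>j\<close> with
        cosine \<open>c\<close> on the diagonal and \<open>s p\<close>, \<open>- s cj p\<close> off
        it; \<open>xy\<close> is the entry by which it could fail to be unitary.\<close>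
      define W where "W = mat 1 + (matrix_unit i i x + (matrix_unit j j x +
         (matrix_unit j i y + matrix_unit i j (- cj y))))"
      have "2 * (c - 1) + (c - 1)\<^sup>2 + s\<^sup>2 = 0"
        using cs by (simp add: power2_eq_square algebra_simps)
      then have "(of_real (2 * (c - 1) + (c - 1)\<^sup>2 + s\<^sup>2) :: 'a) = 0" by simp
      moreover have "cj y * y = of_real (s\<^sup>2)"
        using p by (simp add: y_def cj_mult power2_eq_square mult_ac)
      ultimately have xy: "x + x + x * x + cj y * y = 0"
        by (simp add: x_def power2_eq_square)
      have cx: "cj x = x" unfolding x_def by (rule cj_of_real)
      have "cjt W ** W - mat 1 = matrix_unit i i (x + x + x * x + cj y * y) + matrix_unit j j (x + x + x * x + cj y * y)"
        unfolding W_def using that \<open>i \<noteq> j\<close>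
        by (simp add: cjt_add cjt_matrix_unit matrix_add_ldistrib matrix_add_rdistrib
          matrix_unit_mult cj_minus cx) (auto simp: vec_eq_iff matrix_unit_def algebra_simps)
      then have "cjt W ** W = mat 1" unfolding xy by (simp add: matrix_unit_def vec_eq_iff)
      from max[OF unitaryI[OF this]] have "re (trace (B ** W)) \<le> re (trace B)" .
      moreover have "trace (B ** W) = trace B + of_real (c - 1) * (B $ i $ i + B $ j $ j)
          + of_real s * (B $ i $ j * p - B $ j $ i * cj p)"
        unfolding W_def by (simp add: matrix_add_ldistrib trace_add trace_mult_matrix_unit x_def y_def cj_mult
            algebra_simps)
      ultimately show ?thesis
        unfolding a_def b_def by (simp only: re_add re_of_real_mult)
    qed
    \<comment> \<open>On the unit circle \<open>(c - 1) a + s b\<close> is largest at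
      \<open>(c, s) = (a, b) / r\<close>, where \<open>key\<close> reads r \<le> a. As r^2 = a^2 +
      b^2, this leaves only b = 0.\<close>
    define r where "r = sqrt (a\<^sup>2 + b\<^sup>2)"
    have "b = 0"
    proof (rule ccontr)
      assume "b \<noteq> 0"
      then have r: "r > 0" by (simp add: r_def add_nonneg_pos)
      have r2: "r\<^sup>2 = a\<^sup>2 + b\<^sup>2" by (simp add: r_def)
      have "(a / r)\<^sup>2 + (b / r)\<^sup>2 = 1"
        using r by (simp add: power_divide add_divide_distrib[symmetric] r2[symmetric])
      from key[OF this] have "a\<^sup>2 / r + b\<^sup>2 / r \<le> a"
        by (simp add: power2_eq_square algebra_simps)
      then have "r\<^sup>2 / r \<le> a" unfolding r2 by (simp add: add_divide_distrib)
      then have "r \<le> a" using r by (simp add: power2_eq_square)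
      then have "r\<^sup>2 \<le> a\<^sup>2" using r by (intro power_mono) auto
      with \<open>b \<noteq> 0\<close> show False by (simp add: r2)
    qed
    moreover have "b = re (z * p)"
    proof -
      have "re (B $ j $ i * cj p) = re (cj (B $ j $ i) * p)"
        using re_cj[of "B $ j $ i * cj p"] by (simp add: cj_mult)
      then show ?thesis by (simp add: b_def z_def left_diff_distrib re_diff)
    qed
    moreover have "z * p = of_real (norm z)"
      using z cj_mult_self[of z] by (simp add: p_def power2_eq_square mult.commute)
    ultimately show False using z by simp
  qed
  show "cjt B = B"
  proof -
    have "cj (B $ j $ i) = B $ i $ j" for i j
    proof (cases "i = j")
      case True
      then show ?thesis using arg_cong[OF diag[of i], of cj] diag[of i] by simp
    next
      case False
      then show ?thesis using off[of i j] by simp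
    qed
    then show ?thesis by (simp add: vec_eq_iff cjt_def)
  qed
qed

definition diag :: "real^'d \<Rightarrow> 'a^'d^'d" where
  "diag s = diag_mat (\<chi> i. of_real (s $ i))"

lemma diag_nth: "diag s $ i $ j = (if i = j then of_real (s $ i) else 0)"
  by (simp add: diag_def diag_mat_def)

lemma diag_mult_left: "(diag s ** A) $ i $ j = of_real (s $ i) * A $ i $ j"
  by (simp add: matrix_matrix_mult_def diag_nth if_distrib if_distribR cong: if_cong)

lemma diag_mult_right: "(A ** diag s) $ i $ j = A $ i $ j * of_real (s $ j)"
  by (simp add: matrix_matrix_mult_def diag_nth if_distrib if_distribR cong: if_cong)

lemma cjt_diag: "cjt (diag s) = diag s"
  by (simp add: vec_eq_iff cjt_def diag_nth)

definition svd :: "'a^'d^'d \<Rightarrow> 'a^'d^'d \<Rightarrow> 'a^'d^'d \<Rightarrow> real^'d \<Rightarrow> bool" where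
  "svd G U V s \<longleftrightarrow> unitary U \<and> unitary V \<and> (\<forall>i. 0 \<le> s $ i) \<and> G = U ** diag s ** cjt V"

text \<open>Maximising a weighted trace of \<open>U\<^sup>* G V\<close> with pairwise distinct positive weights diagonalises \<open>G\<close>
  in one step: optimality in \<open>U\<close> and in \<open>V\<close> makes both \<open>DA\<close> and \<open>AD\<close> Hermitian,
  where \<open>A = U\<^sup>* G V\<close> and \<open>D\<close> is the diagonal matrix of the weights.\<close>

lemma svd_exists:
  fixes G :: "'a^'d^'d"
  obtains U V s where "svd G U V s"
proof -
  obtain f :: "'d \<Rightarrow> nat" where f: "inj f"
    using finite_imp_inj_to_nat_seg[of "UNIV :: 'd set"] by auto
  \<comment> \<open>One plus an injective numbering: the weights are positive and distinct, so their
    squares are distinct as well.\<close>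
  define w :: "real^'d" where "w = (\<chi> i. real (f i) + 1)"
  have wpos: "w $ i > 0" for i by (simp add: w_def add_nonneg_pos)
  have winj: "w $ i = w $ j \<longleftrightarrow> i = j" for i j using f by (simp add: w_def inj_eq)
  define K where "K = {U :: 'a^'d^'d. unitary U} \<times> {U :: 'a^'d^'d. unitary U}"
  define \<Phi> where "\<Phi> = (\<lambda>p. re (trace (diag w ** (cjt (fst p) ** G ** snd p))))"
  have "compact K" unfolding K_def by (intro compact_Times compact_unitary)
  moreover have "K \<noteq> {}" using unitary_mat_1 by (auto simp: K_def)
  moreover have "continuous_on K \<Phi>" unfolding \<Phi>_def by (intro continuous_intros)
  ultimately obtain p where p: "p \<in> K" and pmax: "\<And>q. q \<in> K \<Longrightarrow> \<Phi> q \<le> \<Phi> p"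
    using continuous_attains_sup by metis
  obtain U V where UV: "p = (U, V)" by (cases p)
  have U: "unitary U" and V: "unitary V" using p by (auto simp: K_def UV)
  define A where "A = cjt U ** G ** V"
  have 1: "re (trace (diag w ** A ** W)) \<le> re (trace (diag w ** A))" if "unitary W" for W
  proof -
    have "(U, V ** W) \<in> K" using U V that by (simp add: K_def unitary_mult)
    from pmax[OF this] show ?thesis by (simp add: UV \<Phi>_def A_def matrix_mul_assoc)
  qed
  \<comment> \<open>Replacing \<open>U\<close> by \<open>U ** cjt W\<close> puts \<open>W\<close> to
    the left of \<open>A\<close>; cyclicity of the trace makes it a right factor of
    \<open>A ** diag w\<close>, the form that \<open>trace_maximal_hermitian\<close> takes.\<close>
  have 2: "re (trace (A ** diag w ** W)) \<le> re (trace (A ** diag w))" if "unitary W" for W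
  proof -
    have "trace (A ** diag w ** W) = trace ((W ** A) ** diag w)"
      by (subst trace_mul_sym) (simp add: matrix_mul_assoc)
    also have "\<dots> = trace (diag w ** (W ** A))" by (rule trace_mul_sym)
    also have "W ** A = cjt (U ** cjt W) ** G ** V"
      by (simp add: A_def cjt_mult matrix_mul_assoc)
    finally have "trace (A ** diag w ** W) = trace (diag w ** (cjt (U ** cjt W) ** G ** V))" .
    moreover have "trace (A ** diag w) = trace (diag w ** A)" by (rule trace_mul_sym)
    moreover have "(U ** cjt W, V) \<in> K" using U V that by (simp add: K_def unitary_mult unitary_cjt)
    from pmax[OF this] have "re (trace (diag w ** (cjt (U ** cjt W) ** G ** V))) \<le> re (trace (diag w ** A))"
      by (simp add: UV \<Phi>_def A_def)
    ultimately show ?thesis by simp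
  qed
  note h1 = trace_maximal_hermitian[OF 1] and h2 = trace_maximal_hermitian[OF 2]
  define s :: "real^'d" where "s = (\<chi> i. norm (A $ i $ i))"
  have "A $ i $ j = diag s $ i $ j" for i j
  proof -
    have e1: "of_real (w $ j) * cj (A $ j $ i) = of_real (w $ i) * A $ i $ j"
      using arg_cong[OF h1(1), of "\<lambda>M. M $ i $ j"] by (simp add: cjt_def diag_mult_left cj_mult)
    have e2: "cj (A $ j $ i) * of_real (w $ i) = A $ i $ j * of_real (w $ j)"
      using arg_cong[OF h2(1), of "\<lambda>M. M $ i $ j"] by (simp add: cjt_def diag_mult_right cj_mult)
    show ?thesis
    proof (cases "i = j")
      case True
      have "of_real (w $ i) * A $ i $ i = of_real (w $ i) * of_real (norm (A $ i $ i))"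
        using h1(2)[of i] wpos[of i] by (simp add: diag_mult_left norm_mult)
      then show ?thesis using True wpos[of i] by (simp add: diag_nth s_def)
    next
      case False
      \<comment> \<open>Eliminating the conjugated entry between \<open>e1\<close> and
        \<open>e2\<close> gives (w_i^2 - w_j^2) A_ij = 0.\<close>
      have "of_real (w $ i * w $ i) * A $ i $ j = of_real (w $ i) * (of_real (w $ j) * cj (A $ j $ i))"
        unfolding e1 by simp
      also have "\<dots> = of_real (w $ j) * (cj (A $ j $ i) * of_real (w $ i))" by (simp add: mult_ac)
      also have "\<dots> = of_real (w $ j * w $ j) * A $ i $ j" unfolding e2 by (simp add: mult_ac)
      finally have "A $ i $ j = 0 \<or> w $ i * w $ i = w $ j * w $ j"
        unfolding mult_cancel_right of_real_eq_iff .
      moreover have "w $ i * w $ i \<noteq> w $ j * w $ j"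
      proof
        assume "w $ i * w $ i = w $ j * w $ j"
        then have "w $ i = w $ j \<or> w $ i = - w $ j" unfolding square_eq_iff .
        then have "w $ i = - w $ j" using False winj by blast
        then show False using wpos[of i] wpos[of j] by linarith
      qed
      ultimately show ?thesis using False by (simp add: diag_nth)
    qed
  qed
  then have "A = diag s" by (simp add: vec_eq_iff)
  moreover have "U ** A ** cjt V = (U ** cjt U) ** G ** (V ** cjt V)"
    by (simp add: A_def matrix_mul_assoc)
  ultimately have "svd G U V s" using U V by (simp add: svd_def unitary_def s_def)
  then show thesis by (rule that)
qed

end

section \<open>Polar factors and singular values\<close>

lemma mat_mult_nth: "(mat c ** A) $ i $ j = c * (A $ i $ j :: 'a::semiring_1)"
proof -
  have "(\<Sum>k\<in>UNIV. (if i = k then c else 0) * A $ k $ j) = (\<Sum>k\<in>UNIV. if i = k then c * A $ i $ j else 0)"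
    by (rule sum.cong) auto
  then show ?thesis by (simp add: matrix_matrix_mult_def mat_def)
qed

lemma mult_mat_nth: "(A ** mat c) $ i $ j = (A $ i $ j :: 'a::semiring_1) * c"
proof -
  have "(\<Sum>k\<in>UNIV. A $ i $ k * (if k = j then c else 0)) = (\<Sum>k\<in>UNIV. if k = j then A $ i $ j * c else 0)"
    by (rule sum.cong) auto
  then show ?thesis by (simp add: matrix_matrix_mult_def mat_def)
qed

text \<open>The polynomial q(x) = det(I + x G) has q(0) = 1, so it is visibly nonzero. For nonzero
  t, G + t I is t times I + G/t, hence every nonzero zero t yields a root 1/t of q.\<close>

lemma det_add_scalar_zeros_finite:
  fixes G :: "'a::real_normed_field^'n^'n"
  shows "finite {t :: real. det (G + mat (of_real t)) = 0}"
proof -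
  define q :: "'a poly" where
    "q = (\<Sum>p | p permutes UNIV. of_int (sign p) * (\<Prod>i\<in>UNIV. [:(mat 1 :: 'a^'n^'n) $ i $ p i, G $ i $ p i:]))"
  have q: "poly q x = det (mat 1 + (\<chi> i j. x * G $ i $ j))" for x
    by (simp add: q_def det_def poly_sum poly_prod)
  have "poly q 0 = 1"
    unfolding q by (simp add: plus_vec_def vec_lambda_eta)
  then have "q \<noteq> 0" by auto
  then have "finite {x. poly q x = 0}" by (rule poly_roots_finite)
  then have "finite ((\<lambda>t. of_real (inverse t) :: 'a) -` {x. poly q x = 0})"
    by (rule finite_vimageI) (auto intro!: injI)
  moreover have "{t. det (G + mat (of_real t)) = 0} \<subseteq> insert 0 ((\<lambda>t. of_real (inverse t)) -` {x. poly q x = 0})"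
  proof clarsimp
    fix t :: real
    assume t: "det (G + mat (of_real t)) = 0" "t \<noteq> 0"
    have "mat 1 + (\<chi> i j. inverse (of_real t) * G $ i $ j) = mat (inverse (of_real t)) ** (G + mat (of_real t))"
      using t(2) by (simp add: vec_eq_iff mat_mult_nth distrib_left) (simp add: mat_def)
    then show "poly q (inverse (of_real t)) = 0"
      unfolding q by (simp add: det_mul t)
  qed
  ultimately show ?thesis using finite_subset by blast
qed

text \<open>Fubini along the lines G + t I: each line meets the singular matrices in finitely many
  t. Averaging the translates of the set over all t thus shows that its measure times infinity is
  zero.\<close>

lemma det_zero_null:
  "{G :: 'a::{real_normed_field,euclidean_space}^'n^'n. det G = 0} \<in> null_sets lborel"
proof -
  let ?N = "{G :: 'a^'n^'n. det G = 0}"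
  let ?I = "indicator ?N :: _ \<Rightarrow> ennreal"
  let ?m = "\<lambda>t::real. mat (of_real t) :: 'a^'n^'n"
  have "closed ?N" by (intro closed_Collect_eq continuous_intros)
  then have N: "?N \<in> sets borel" by (rule borel_closed)
  then have [measurable]: "?I \<in> borel_measurable borel" by simp
  have "?m t = t *\<^sub>R mat 1" for t by (simp add: vec_eq_iff mat_def of_real_def)
  then have [measurable]: "?m \<in> borel_measurable borel"
    by (simp add: borel_measurable_continuous_onI continuous_intros)
  have "emeasure lborel ?N * emeasure lborel (UNIV :: real set) = (\<integral>\<^sup>+(t::real). emeasure lborel ?N \<partial>lborel)"
    by simp
  also have "\<dots> = (\<integral>\<^sup>+(t::real). (\<integral>\<^sup>+G. ?I G \<partial>distr lborel borel ((+) (?m t))) \<partial>lborel)"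
    using N by (simp add: lborel_distr_plus)
  also have "\<dots> = (\<integral>\<^sup>+(t::real). (\<integral>\<^sup>+G. ?I (?m t + G) \<partial>lborel) \<partial>lborel)"
    by (simp add: nn_integral_distr)
  also have "\<dots> = (\<integral>\<^sup>+G. (\<integral>\<^sup>+(t::real). ?I (?m t + G) \<partial>lborel) \<partial>lborel)"
    by (rule lborel_pair.Fubini') measurable
  also have "\<dots> = (\<integral>\<^sup>+(G::'a^'n^'n). 0 \<partial>lborel)"
  proof (rule nn_integral_cong)
    fix G :: "'a^'n^'n"
    have "finite {t. det (G + ?m t) = 0}" by (rule det_add_scalar_zeros_finite)
    then have "{t. det (G + ?m t) = 0} \<in> null_sets lborel" by (rule finite_imp_null_set_lborel)
    from AE_not_in[OF this] have "AE t in lborel. det (G + ?m t) \<noteq> 0" by simp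
    then have "AE t in lborel. ?I (?m t + G) = 0" by eventually_elim (simp add: add.commute)
    then have "(\<integral>\<^sup>+t. ?I (?m t + G) \<partial>lborel) = (\<integral>\<^sup>+(t::real). 0 \<partial>lborel)" by (rule nn_integral_cong_AE)
    then show "(\<integral>\<^sup>+t. ?I (?m t + G) \<partial>lborel) = 0" by simp
  qed
  finally show ?thesis using N by (simp add: null_sets_def)
qed

lemma AE_gaussian_det_nonzero:
  "AE G in gaussian v. det (G :: 'a::{real_normed_field,euclidean_space}^'n^'n) \<noteq> 0"
proof -
  have "AE G in lborel. det (G :: 'a^'n^'n) \<noteq> 0"
    using AE_not_in[OF det_zero_null] by simp
  then show ?thesis
    unfolding gaussian_def by (subst AE_density) auto
qed

section \<open>Nearest unitary matrix and its measurable substitute\<close>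

context star_field
begin

lemma unitary_det_nonzero: "unitary U \<Longrightarrow> det U \<noteq> 0"
proof
  assume U: "unitary U" "det U = 0"
  have "det (cjt U ** U) = 1" using U(1) by (simp add: unitary_def)
  then show False using U(2) by (simp add: det_mul)
qed

text \<open>The identity behind von Neumann's trace inequality: for unitary \<open>Z\<close> the
  matrix \<open>cjt V ** cjt Z ** U\<close> is unitary, so its diagonal weighs each singular value
  by at most 1.\<close>

lemma svd_inner:
  assumes "svd G U V s"
  shows "Z \<bullet> G = (\<Sum>i\<in>UNIV. s $ i * re ((cjt V ** cjt Z ** U) $ i $ i))"
proof -
  have "trace (cjt Z ** G) = trace ((cjt Z ** U ** diag s) ** cjt V)"
    using assms by (simp add: svd_def matrix_mul_assoc)
  also have "\<dots> = trace ((cjt V ** cjt Z ** U) ** diag s)"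
    by (subst trace_mul_sym) (simp add: matrix_mul_assoc)
  also have "\<dots> = trace (diag s ** (cjt V ** cjt Z ** U))" by (rule trace_mul_sym)
  finally show ?thesis by (simp add: inner_matrix trace_def diag_mult_left re_sum re_of_real_mult)
qed

lemma svd_unitary_entry:
  assumes "svd G U V s" "unitary Z"
  shows "unitary (cjt V ** cjt Z ** U)" and "re ((cjt V ** cjt Z ** U) $ i $ i) \<le> 1"
proof -
  show u: "unitary (cjt V ** cjt Z ** U)"
    using assms by (simp add: svd_def unitary_mult unitary_cjt)
  show "re ((cjt V ** cjt Z ** U) $ i $ i) \<le> 1"
    using re_le_norm unitary_entry_le[OF u] by (rule order_trans)
qed

lemma svd_inner_le:
  assumes "svd G U V s" "unitary Z"
  shows "Z \<bullet> G \<le> (\<Sum>i\<in>UNIV. s $ i)"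
  unfolding svd_inner[OF assms(1)]
proof (rule sum_mono)
  fix i
  have "0 \<le> s $ i" using assms by (simp add: svd_def)
  then show "s $ i * re ((cjt V ** cjt Z ** U) $ i $ i) \<le> s $ i"
    using svd_unitary_entry(2)[OF assms] by (rule mult_left_le[rotated])
qed

lemma svd_inner_eq:
  assumes "svd G U V s"
  shows "(U ** cjt V) \<bullet> G = (\<Sum>i\<in>UNIV. s $ i)"
proof -
  have "cjt V ** cjt (U ** cjt V) ** U = (cjt V ** V) ** (cjt U ** U)"
    by (simp add: cjt_mult matrix_mul_assoc)
  also have "\<dots> = mat 1" using assms by (simp add: svd_def unitary_def)
  finally show ?thesis unfolding svd_inner[OF assms] using re_of_real[of 1] by (simp add: mat_def)
qed

lemma svd_inner_unique:
  fixes G :: "'a^'d^'d"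
  assumes G: "svd G U V s" and Z: "unitary Z" and pos: "\<And>i. s $ i > 0"
    and ge: "(\<Sum>i\<in>UNIV. s $ i) \<le> Z \<bullet> G"
  shows "Z = U ** cjt V"
proof -
  define Q where "Q = cjt V ** cjt Z ** U"
  have Q: "unitary Q" and le: "re (Q $ i $ i) \<le> 1" for i
    using svd_unitary_entry[OF G Z] by (simp_all add: Q_def)
  have "(\<Sum>i\<in>UNIV. s $ i * (1 - re (Q $ i $ i))) \<le> 0"
    using ge unfolding svd_inner[OF G] by (simp add: Q_def right_diff_distrib sum_subtractf)
  moreover have nonneg: "0 \<le> s $ i * (1 - re (Q $ i $ i))" for i
    using pos[of i] le[of i] by simp
  ultimately have "(\<Sum>i\<in>UNIV. s $ i * (1 - re (Q $ i $ i))) = 0"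
    by (intro antisym sum_nonneg) auto
  then have "s $ i * (1 - re (Q $ i $ i)) = 0" for i
    using nonneg by (subst (asm) sum_nonneg_eq_0_iff) auto
  then have one: "re (Q $ i $ i) = 1" for i
    using pos[of i] by (metis less_irrefl mult_eq_0_iff eq_iff_diff_eq_0)
  \<comment> \<open>Equality forces every diagonal entry of \<open>Q\<close> to have real part 1, so
    |Q - I|^2 = d + d - 2d = 0.\<close>
  have "Q \<bullet> mat 1 = real CARD('d)"
    by (subst inner_commute) (simp add: inner_matrix trace_def re_sum one)
  then have "(norm (Q - mat 1))\<^sup>2 = 0"
    using unitary_norm_square[OF Q] unitary_norm_square[OF unitary_mat_1, where 'd='d] dot_norm_neg[of Q "mat 1"]
    by simp
  then have "Q = mat 1" by simp
  then have "V ** Q ** cjt U = V ** cjt U" by simp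
  moreover have "V ** Q ** cjt U = (V ** cjt V) ** cjt Z ** (U ** cjt U)"
    by (simp add: Q_def matrix_mul_assoc)
  ultimately have "cjt Z = V ** cjt U"
    using G by (simp add: svd_def unitary_def)
  then have "cjt (cjt Z) = U ** cjt V" by (simp only: cjt_mult cjt_cjt)
  then show ?thesis by simp
qed

text \<open>All unitary matrices have the same Frobenius norm, so expanding the squared distance
  leaves only the inner product to compare.\<close>

lemma unitary_distance_le_iff:
  assumes "unitary Z" "unitary W"
  shows "norm (Z - G) \<le> norm (W - G) \<longleftrightarrow> W \<bullet> G \<le> Z \<bullet> G"
proof -
  have "W \<bullet> G \<le> Z \<bullet> G \<longleftrightarrow> (norm (Z - G))\<^sup>2 \<le> (norm (W - G))\<^sup>2"
    unfolding dot_norm_neg using assms by (simp add: unitary_norm_square)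
  then show ?thesis by (simp add: abs_le_square_iff[symmetric])
qed

definition proj :: "'a^'d^'d \<Rightarrow> 'a^'d^'d" where
  "proj X = (SOME Z. unitary Z \<and> (\<forall>W. unitary W \<longrightarrow> norm (Z - X) \<le> norm (W - X)))"

lemma proj_svd:
  assumes G: "svd G U V s" and pos: "\<And>i. s $ i > 0"
  shows "proj G = U ** cjt V"
  unfolding proj_def
proof (rule some_equality)
  have UV: "unitary (U ** cjt V)" using G by (simp add: svd_def unitary_mult unitary_cjt)
  then show "unitary (U ** cjt V) \<and> (\<forall>W. unitary W \<longrightarrow> norm (U ** cjt V - G) \<le> norm (W - G))"
    using svd_inner_le[OF G] by (simp add: unitary_distance_le_iff svd_inner_eq[OF G])
  fix Z assume Z: "unitary Z \<and> (\<forall>W. unitary W \<longrightarrow> norm (Z - G) \<le> norm (W - G))"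
  then have "(U ** cjt V) \<bullet> G \<le> Z \<bullet> G" using UV unitary_distance_le_iff[of Z "U ** cjt V" G] by simp
  then show "Z = U ** cjt V" using Z svd_inner_unique[OF G _ pos] by (simp add: svd_inner_eq[OF G])
qed

lemma svd_det_nonzero:
  assumes "svd G U V s" "det G \<noteq> 0"
  shows "s $ i > 0"
proof -
  have "det (diag s) = (\<Prod>i\<in>UNIV. of_real (s $ i))"
    by (subst det_diagonal) (auto simp: diag_nth)
  moreover have "det (diag s) \<noteq> 0" using assms by (auto simp: svd_def det_mul)
  ultimately have "s $ i \<noteq> 0" by auto
  moreover have "0 \<le> s $ i" using assms by (simp add: svd_def)
  ultimately show ?thesis by simp
qed

lemma svd_cjt: "svd G U V s \<Longrightarrow> cjt G = V ** diag s ** cjt U"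
  by (simp add: svd_def cjt_mult cjt_diag matrix_mul_assoc)

lemma
  assumes "det G \<noteq> 0"
  shows proj_unitary: "unitary (proj G)"
    and proj_inner_max: "unitary W \<Longrightarrow> W \<bullet> G \<le> proj G \<bullet> G"
    and proj_inner_unique: "unitary Z \<Longrightarrow> proj G \<bullet> G \<le> Z \<bullet> G \<Longrightarrow> Z = proj G"
    and trace_proj: "trace (proj G ** cjt G) = of_real (proj G \<bullet> G)"
proof -
  obtain U V s where G: "svd G U V s" by (rule svd_exists)
  note pos = svd_det_nonzero[OF G assms]
  note eq = proj_svd[OF G pos]
  show "unitary (proj G)" unfolding eq using G by (simp add: svd_def unitary_mult unitary_cjt)
  show "unitary W \<Longrightarrow> W \<bullet> G \<le> proj G \<bullet> G"
    unfolding eq svd_inner_eq[OF G] by (rule svd_inner_le[OF G])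
  show "unitary Z \<Longrightarrow> proj G \<bullet> G \<le> Z \<bullet> G \<Longrightarrow> Z = proj G"
    unfolding eq svd_inner_eq[OF G] by (rule svd_inner_unique[OF G _ pos])
  \<comment> \<open>This product is \<open>U ** diag s ** cjt U\<close>, the Hermitian factor of the
    polar decomposition, and so its trace is real.\<close>
  have "proj G ** cjt G = U ** (cjt V ** V) ** diag s ** cjt U"
    by (simp only: eq svd_cjt[OF G] matrix_mul_assoc)
  then have "proj G ** cjt G = U ** diag s ** cjt U" using G by (simp add: svd_def unitary_def)
  then have "cjt (proj G ** cjt G) = proj G ** cjt G" by (simp add: cjt_mult cjt_diag matrix_mul_assoc)
  then have "cj (trace (proj G ** cjt G)) = trace (proj G ** cjt G)" by (metis trace_cjt)
  then have "trace (proj G ** cjt G) = of_real (re (trace (proj G ** cjt G)))" by (rule cj_eq_selfD)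
  also have "re (trace (proj G ** cjt G)) = re (trace (cjt (proj G ** cjt G)))" by (simp add: trace_cjt)
  also have "\<dots> = re (trace (G ** cjt (proj G)))" by (simp add: cjt_mult)
  also have "\<dots> = proj G \<bullet> G" by (subst trace_mul_sym) (simp add: inner_matrix)
  finally show "trace (proj G ** cjt G) = of_real (proj G \<bullet> G)" .
qed

text \<open>Closed graph theorem for a compact range: being a maximiser of the inner product is a
  closed condition on the pair, and uniqueness of the maximiser makes it describe exactly the graph
  over nonsingular matrices.\<close>

lemma continuous_on_proj: "continuous_on {G :: 'a^'d^'d. det G \<noteq> 0} proj"
proof -
  let ?S = "{G :: 'a^'d^'d. det G \<noteq> 0}" and ?T = "{U :: 'a^'d^'d. unitary U}"
  have "(\<lambda>G. (G, proj G)) ` ?S = (?S \<times> ?T) \<inter> (\<Inter>W\<in>?T. {p. W \<bullet> fst p \<le> snd p \<bullet> fst p})"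
  proof (intro set_eqI iffI)
    fix p assume "p \<in> (\<lambda>G. (G, proj G)) ` ?S"
    then show "p \<in> (?S \<times> ?T) \<inter> (\<Inter>W\<in>?T. {p. W \<bullet> fst p \<le> snd p \<bullet> fst p})"
      by (auto simp: proj_unitary proj_inner_max)
  next
    fix p assume p: "p \<in> (?S \<times> ?T) \<inter> (\<Inter>W\<in>?T. {p. W \<bullet> fst p \<le> snd p \<bullet> fst p})"
    then have "snd p = proj (fst p)"
      by (intro proj_inner_unique) (auto simp: proj_unitary)
    then have "p = (fst p, proj (fst p))" by (simp add: prod_eq_iff)
    moreover have "fst p \<in> ?S" using p by auto
    ultimately show "p \<in> (\<lambda>G. (G, proj G)) ` ?S" by (rule image_eqI)
  qed
  moreover have "closed (\<Inter>W\<in>?T. {p. W \<bullet> fst p \<le> snd p \<bullet> fst p})"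
    by (intro closed_INT ballI closed_Collect_le continuous_intros)
  ultimately have "closedin (top_of_set (?S \<times> ?T)) ((\<lambda>G. (G, proj G)) ` ?S)"
    by (simp only: closedin_closed_Int)
  then show ?thesis
    using proj_unitary by (subst continuous_closed_graph_eq[OF compact_unitary]) auto
qed

text \<open>A measurable substitute for \<open>proj\<close>, whose value at singular inputs is an
  unspecified choice. The default 0 keeps \<open>polar_mult_left\<close> and
  \<open>trace_polar\<close> free of a determinant condition.\<close>

definition polar :: "'a^'d^'d \<Rightarrow> 'a^'d^'d" where
  "polar G = (if det G \<noteq> 0 then proj G else 0)"

lemma polar_measurable [measurable]: "polar \<in> borel_measurable borel"
proof -
  have "open {G :: 'a^'d^'d. det G \<noteq> 0}"
    by (intro open_Collect_neq continuous_intros)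
  then have "(\<lambda>G :: 'a^'d^'d. if G \<in> {G. det G \<noteq> 0} then proj G else 0) \<in> borel_measurable borel"
    by (intro borel_measurable_continuous_on_if continuous_on_proj continuous_on_const borel_open)
  then show ?thesis by (simp add: polar_def[abs_def])
qed

lemma norm_polar_le: "norm (polar G :: 'a^'d^'d) \<le> sqrt (real CARD('d))"
proof (cases "det G = 0")
  case False
  then have "(norm (polar G))\<^sup>2 = real CARD('d)"
    by (simp add: polar_def unitary_norm_square proj_unitary)
  then show ?thesis by (simp add: real_le_rsqrt)
qed (simp add: polar_def)

text \<open>Moving \<open>Q\<close> across the inner product shows that \<open>Q ** proj G\<close>
  is a maximiser for \<open>Q ** G\<close>; uniqueness then identifies it.\<close>

lemma polar_mult_left:
  assumes Q: "unitary Q" shows "polar (Q ** G) = Q ** polar G"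
proof (cases "det G = 0")
  case False
  have QG: "det (Q ** G) \<noteq> 0" using False Q by (simp add: det_mul unitary_det_nonzero)
  have inner: "Z \<bullet> (Q ** G) = (cjt Q ** Z) \<bullet> G" for Z
    by (simp add: inner_matrix_left)
  have "Q ** proj G = proj (Q ** G)"
  proof (rule proj_inner_unique[OF QG])
    show "unitary (Q ** proj G)" using Q False by (simp add: unitary_mult proj_unitary)
    have "cjt Q ** (Q ** proj G) = proj G" using Q by (simp add: matrix_mul_assoc unitary_def)
    then show "proj (Q ** G) \<bullet> (Q ** G) \<le> (Q ** proj G) \<bullet> (Q ** G)"
      unfolding inner using False QG Q by (simp add: proj_inner_max unitary_mult unitary_cjt proj_unitary)
  qed
  then show ?thesis using False QG by (simp add: polar_def)
qed (simp add: polar_def det_mul)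

lemma trace_polar: "trace (polar G ** cjt G) = of_real (polar G \<bullet> G)"
  by (simp add: polar_def trace_proj) (simp add: trace_def)

section \<open>Uniqueness of the multiset of singular values\<close>

definition sing_vals :: "'a^'d^'d \<Rightarrow> real multiset" where
  "sing_vals G = (THE M. \<exists>U V s. unitary U \<and> unitary V \<and> (\<forall>i. 0 \<le> s $ i) \<and>
      G = U ** diag_mat (\<chi> i. of_real (s $ i)) ** cjt V \<and>
      M = image_mset (\<lambda>i. s $ i) (mset_set UNIV))"

text \<open>\<open>G ** cjt G\<close> is unitarily similar to the square of \<open>diag s\<close>.
  The left side depends on \<open>G\<close> alone, which is what makes the \<open>THE\<close> in
  \<open>sing_vals\<close> well defined.\<close>

lemma svd_charpoly:
  fixes G :: "'a^'d^'d"
  assumes "svd G U V s"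
  shows "det (mat x - G ** cjt G) = poly (\<Prod>i\<in>UNIV. [:- of_real ((s $ i)\<^sup>2), 1:]) x"
proof -
  have U: "U ** cjt U = mat 1" using assms by (simp add: svd_def unitary_def)
  have V: "cjt V ** V = mat 1" and G: "G = U ** diag s ** cjt V"
    using assms by (simp_all add: svd_def unitary_def)
  have "G ** cjt G = (U ** diag s ** cjt V) ** (V ** diag s ** cjt U)"
    by (subst svd_cjt[OF assms], subst G) (rule refl)
  also have "\<dots> = U ** diag s ** (cjt V ** V) ** diag s ** cjt U"
    by (simp only: matrix_mul_assoc)
  finally have GG: "G ** cjt G = U ** (diag s ** diag s) ** cjt U"
    by (simp add: V matrix_mul_assoc)
  have "U ** mat x = mat x ** U"
    by (simp add: vec_eq_iff mat_mult_nth mult_mat_nth mult.commute)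
  then have "U ** mat x ** cjt U = mat x ** (U ** cjt U)" by (simp add: matrix_mul_assoc)
  then have "mat x - G ** cjt G = U ** (mat x - diag s ** diag s) ** cjt U"
    by (simp add: GG matrix_diff_ldistrib matrix_diff_rdistrib U)
  then have "det (mat x - G ** cjt G) = det (U ** cjt U) * det (mat x - diag s ** diag s)"
    by (simp only: det_mul mult_ac)
  also have "\<dots> = det (mat x - diag s ** diag s)" by (simp add: U)
  also have "\<dots> = (\<Prod>i\<in>UNIV. x - of_real ((s $ i)\<^sup>2))"
    by (subst det_diagonal) (auto simp: diag_mult_left diag_nth mat_def power2_eq_square)
  also have "\<dots> = poly (\<Prod>i\<in>UNIV. [:- of_real ((s $ i)\<^sup>2), 1:]) x"
    by (simp add: poly_prod)
  finally show ?thesis .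
qed

lemma svd_unique:
  fixes G :: "'a^'d^'d"
  assumes "svd G U V s" "svd G U' V' s'"
  shows "image_mset (($) s) (mset_set UNIV) = image_mset (($) s') (mset_set UNIV)"
proof -
  define P :: "real^'d \<Rightarrow> 'a poly" where "P s = (\<Prod>i\<in>UNIV. [:- of_real ((s $ i)\<^sup>2), 1:])" for s
  have roots: "proots (P s) = image_mset (\<lambda>i. of_real ((s $ i)\<^sup>2)) (mset_set UNIV)" for s
    unfolding P_def by (subst proots_prod) (auto simp: sum_unfold_sum_mset)
  \<comment> \<open>Nonnegativity lets the square root undo the squaring; \<open>re\<close> brings
    the roots back from the field to the reals.\<close>
  have recover: "image_mset (\<lambda>x. sqrt (re x)) (proots (P s)) = image_mset (($) s) (mset_set UNIV)"
    if "\<And>i. 0 \<le> s $ i" for s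
    unfolding roots using that by (simp add: image_mset.compositionality comp_def del: of_real_power)
  have "poly (P s) = poly (P s')"
    using svd_charpoly[OF assms(1)] svd_charpoly[OF assms(2)] by (auto simp: P_def)
  then have "P s = P s'" by (simp only: poly_eq_poly_eq_iff)
  then show ?thesis
    using recover[of s] recover[of s'] assms by (simp add: svd_def)
qed

lemma sum_sing_vals:
  fixes G :: "'a^'d^'d"
  assumes G: "det G \<noteq> 0"
  shows "sum_mset (sing_vals G) = polar G \<bullet> G"
proof -
  obtain U V s where s: "svd G U V s" by (rule svd_exists)
  have "sing_vals G = image_mset (($) s) (mset_set UNIV)"
    unfolding sing_vals_def
  proof (rule the_equality)
    show "\<exists>U V s'. unitary U \<and> unitary V \<and> (\<forall>i. 0 \<le> s' $ i) \<and>
      G = U ** diag_mat (\<chi> i. of_real (s' $ i)) ** cjt V \<and>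
      image_mset (($) s) (mset_set UNIV) = image_mset (\<lambda>i. s' $ i) (mset_set UNIV)"
      using s unfolding svd_def diag_def by blast
    fix M assume "\<exists>U V s. unitary U \<and> unitary V \<and> (\<forall>i. 0 \<le> s $ i) \<and>
      G = U ** diag_mat (\<chi> i. of_real (s $ i)) ** cjt V \<and> M = image_mset (\<lambda>i. s $ i) (mset_set UNIV)"
    then obtain U' V' s' where "svd G U' V' s'" "M = image_mset (($) s') (mset_set UNIV)"
      unfolding svd_def diag_def by auto
    then show "M = image_mset (($) s) (mset_set UNIV)" using svd_unique[OF s] by simp
  qed
  then have "sum_mset (sing_vals G) = (\<Sum>i\<in>UNIV. s $ i)" by (simp add: sum_unfold_sum_mset)
  also have "\<dots> = polar G \<bullet> G"
    using G proj_svd[OF s svd_det_nonzero[OF s G]] svd_inner_eq[OF s] by (simp add: polar_def)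
  finally show ?thesis .
qed

end

section \<open>Moments of the polar factor of a Gaussian matrix\<close>

lemma bounded_bilinear_matrix_mult:
  "bounded_bilinear (\<lambda>(A :: 'a::{real_normed_field,euclidean_space}^'m^'n) (B :: 'a^'k^'m). A ** B)"
  unfolding bilinear_conv_bounded_bilinear[symmetric] bilinear_def
  by (auto intro!: linearI simp: matrix_add_ldistrib matrix_add_rdistrib matrix_scaleR_left matrix_scaleR_right)

lemmas bounded_linear_matrix_mult_left = bounded_bilinear.bounded_linear_left[OF bounded_bilinear_matrix_mult]
  and bounded_linear_matrix_mult_right = bounded_bilinear.bounded_linear_right[OF bounded_bilinear_matrix_mult]

lemma borel_measurable_matrix_mult [measurable (raw)]:
  fixes f :: "'x \<Rightarrow> 'a::{real_normed_field,euclidean_space}^'m^'n" and g :: "'x \<Rightarrow> 'a^'k^'m"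
  assumes "f \<in> borel_measurable M" "g \<in> borel_measurable M"
  shows "(\<lambda>x. f x ** g x) \<in> borel_measurable M"
  using assms by (rule borel_measurable_continuous_Pair) (intro continuous_intros)

lemma bounded_linear_trace:
  "bounded_linear (trace :: 'a::{real_normed_field,euclidean_space}^'n^'n \<Rightarrow> 'a)"
  unfolding linear_conv_bounded_linear[symmetric]
  by (intro linearI) (auto simp: trace_def sum.distrib scaleR_sum_right)

lemma eq_reflectionD:
  fixes a b :: "'v::real_vector"
  assumes "a = 2 *\<^sub>R b - a" shows "a = b"
proof -
  have "2 *\<^sub>R a = 2 *\<^sub>R b" using assms by (simp only: scaleR_2 eq_diff_eq)
  then show ?thesis by simp
qed

context star_field
begin

lemma norm_cjt [simp]: "norm (cjt A) = norm A"
proof -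
  have "cjt A \<bullet> cjt A = A \<bullet> A"
    unfolding inner_matrix cjt_cjt by (subst trace_mul_sym) (rule refl)
  then show ?thesis by (simp add: norm_eq)
qed

lemma trace_self: "trace (R ** cjt R) = of_real ((norm R)\<^sup>2)"
proof -
  have "cj (trace (R ** cjt R)) = trace (R ** cjt R)"
    unfolding trace_cjt[symmetric] cjt_mult cjt_cjt ..
  then have "trace (R ** cjt R) = of_real (re (trace (R ** cjt R)))" by (rule cj_eq_selfD)
  also have "re (trace (R ** cjt R)) = cjt R \<bullet> cjt R" by (simp only: inner_matrix cjt_cjt)
  finally show ?thesis by (simp add: dot_square_norm)
qed

lemma cjt_measurable [measurable (raw)]:
  assumes "f \<in> borel_measurable M" shows "(\<lambda>x. cjt (f x)) \<in> borel_measurable M"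
  using assms by (rule borel_measurable_continuous_on[rotated]) (intro continuous_intros)

text \<open>A Schur-type lemma from two families of unitary matrices present over both fields: sign
  changes kill the off-diagonal entries, transpositions equalise the diagonal.\<close>

lemma unitary_invariant_scalar:
  fixes M :: "'a^'d^'d"
  assumes inv: "\<And>U. unitary U \<Longrightarrow> U ** M ** cjt U = M"
  shows "M = mat (trace M / of_nat CARD('d))"
proof -
  have off: "M $ i $ j = 0" if "i \<noteq> j" for i j
  proof -
    define s :: "real^'d" where "s = (\<chi> k. if k = i then -1 else 1)"
    have "unitary (diag s)"
      by (rule unitaryI) (auto simp: vec_eq_iff cjt_diag diag_mult_left diag_nth s_def mat_def)
    from inv[OF this] have "(diag s ** M ** diag s) $ i $ j = M $ i $ j" by (simp add: cjt_diag)
    then have "- M $ i $ j = M $ i $ j"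
      using that by (simp add: diag_mult_left diag_mult_right s_def)
    then show ?thesis by (simp add: neg_equal_zero)
  qed
  have eq: "M $ i $ i = M $ j $ j" for i j
  proof -
    define \<pi> where "\<pi> a = (if a = i then j else if a = j then i else a)" for a
    define P :: "'a^'d^'d" where "P = (\<chi> a b. if b = \<pi> a then 1 else 0)"
    have PA: "(P ** A) $ a $ b = A $ \<pi> a $ b" for A :: "'a^'d^'d" and a b
    proof -
      have "(P ** A) $ a $ b = (\<Sum>c\<in>UNIV. if c = \<pi> a then A $ \<pi> a $ b else 0)"
        unfolding matrix_matrix_mult_def P_def vec_lambda_beta by (rule sum.cong) auto
      then show ?thesis by simp
    qed
    have PAP: "(P ** A ** cjt P) $ a $ b = A $ \<pi> a $ \<pi> b" for A :: "'a^'d^'d" and a b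
    proof -
      have "(P ** A ** cjt P) $ a $ b = (\<Sum>c\<in>UNIV. if c = \<pi> b then (P ** A) $ a $ \<pi> b else 0)"
        unfolding matrix_matrix_mult_def[of _ "cjt P"] vec_lambda_beta
        by (rule sum.cong) (auto simp: cjt_def P_def)
      then show ?thesis by (simp add: PA)
    qed
    have "(P ** cjt P) $ a $ b = mat 1 $ a $ b" for a b
    proof -
      have "(P ** cjt P) $ a $ b = mat 1 $ \<pi> a $ \<pi> b" using PAP[of "mat 1" a b] by simp
      then show ?thesis by (auto simp: mat_def \<pi>_def)
    qed
    then have "P ** cjt P = mat 1" by (simp add: vec_eq_iff)
    then have "unitary P" by (simp add: unitary_def matrix_left_right_inverse)
    from inv[OF this] have "(P ** M ** cjt P) $ i $ i = M $ i $ i" by simp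
    then show ?thesis unfolding PAP by (simp add: \<pi>_def)
  qed
  define c where "c = M $ undefined $ undefined"
  have M: "M = mat c"
    using off eq[of _ undefined] by (auto simp: vec_eq_iff mat_def c_def)
  have "trace M = of_nat CARD('d) * c" unfolding M by (simp add: trace_def mat_def)
  then show ?thesis using M by simp
qed

lemma linear_mult_left: "linear (\<lambda>R. X ** (R :: 'a^'k^'m))"
  by (intro linearI) (auto simp: matrix_add_ldistrib matrix_scaleR_right)

text \<open>Left multiplication by \<open>X\<close> has adjoint left multiplication by
  \<open>cjt X\<close>, so the hypothesis makes it a coisometry. This serves the \<open>X_i\<close>,
  square unitary matrices and the reflection alike.\<close>

lemma gaussian_distr_mult_left:
  fixes X :: "'a^'m^'n"
  assumes "v > 0" and "X ** cjt X = mat 1"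
  shows "distr (gaussian v) borel (\<lambda>R :: 'a^'k^'m. X ** R) = gaussian v"
proof (rule gaussian_distr_coisometry[OF assms(1)])
  show "X ** (cjt X ** G) = G" for G :: "'a^'k^'n"
    using assms(2) by (simp add: matrix_mul_assoc)
qed (auto intro: linear_mult_left simp: inner_matrix_left)

lemma integral_mult_left_invariant:
  fixes X :: "'a^'m^'n" and f :: "'a^'k^'n \<Rightarrow> 'b::{banach,second_countable_topology}"
  assumes "v > 0" and "X ** cjt X = mat 1" and [measurable]: "f \<in> borel_measurable borel"
  shows "(\<integral>R. f (X ** R) \<partial>gaussian v) = (\<integral>G. f G \<partial>gaussian v)"
  unfolding gaussian_distr_mult_left[OF assms(1,2), symmetric] by (subst integral_distr) auto

text \<open>The linear growth bound fits both the bounded \<open>polar\<close> and linear functions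
  of the sample; their product is at most quadratic, within reach of the Gaussian second
  moment.\<close>

lemma integrable_gaussian_quadratic:
  fixes f :: "'e::euclidean_space \<Rightarrow> 'a^'m^'n" and g :: "'e \<Rightarrow> 'a^'m^'k"
  assumes v: "v > 0" and [measurable]: "f \<in> borel_measurable borel" "g \<in> borel_measurable borel"
    and f: "\<And>x. norm (f x) \<le> a * (1 + norm x)" and g: "\<And>x. norm (g x) \<le> b * (1 + norm x)"
    and ab: "a \<ge> 0" "b \<ge> 0"
  shows "integrable (gaussian v) (\<lambda>x. f x ** cjt (g x))"
proof -
  interpret prob_space "gaussian v :: 'e measure" using v by (rule prob_space_gaussian)
  obtain K where K: "K > 0" "\<And>(A :: 'a^'m^'n) (B :: 'a^'k^'m). norm (A ** B) \<le> norm A * norm B * K"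
    using bounded_bilinear.pos_bounded[OF bounded_bilinear_matrix_mult] by metis
  have "integrable (gaussian v) (\<lambda>x::'e. a * b * K * (1 + 2 * norm x + (norm x)\<^sup>2))"
    using gaussian_norm_integrable[OF v] gaussian_norm_square(1)[OF v]
    by (intro integrable_mult_right Bochner_Integration.integrable_add) auto
  moreover have "norm (f x ** cjt (g x)) \<le> norm (a * b * K * (1 + 2 * norm x + (norm x)\<^sup>2))" for x :: 'e
  proof -
    have "norm (f x ** cjt (g x)) \<le> norm (f x) * norm (g x) * K"
      using K(2)[of "f x" "cjt (g x)"] by simp
    also have "\<dots> \<le> (a * (1 + norm x)) * (b * (1 + norm x)) * K"
      using K(1) ab f g by (intro mult_right_mono mult_mono) auto
    also have "\<dots> = a * b * K * (1 + 2 * norm x + (norm x)\<^sup>2)"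
      by (simp add: power2_eq_square algebra_simps)
    finally show ?thesis by simp
  qed
  then have "AE x in gaussian v. norm (f x ** cjt (g x)) \<le> norm (a * b * K * (1 + 2 * norm x + (norm x)\<^sup>2))"
    by (intro AE_I2)
  moreover have "(\<lambda>x. f x ** cjt (g x)) \<in> borel_measurable (gaussian v)" by measurable
  ultimately show ?thesis using Bochner_Integration.integrable_bound by blast
qed

text \<open>Unitary invariance makes the moment scalar. Its trace is the expected squared norm, one
  \<open>v\<close> for each of the m k DIM real coordinates, and division by m gives the
  constant.\<close>

lemma gaussian_covariance:
  assumes v: "v > 0"
  shows "integrable (gaussian v) (\<lambda>R :: 'a^'k^'m. R ** cjt R)"
    and "(\<integral>R. R ** cjt (R :: 'a^'k^'m) \<partial>gaussian v) = mat (of_real (real CARD('k) * real DIM('a) * v))"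
proof -
  show int: "integrable (gaussian v) (\<lambda>R :: 'a^'k^'m. R ** cjt R)"
    by (rule integrable_gaussian_quadratic[OF v, of _ _ 1 1]) auto
  define M where "M = (\<integral>R. R ** cjt (R :: 'a^'k^'m) \<partial>gaussian v)"
  have "U ** M ** cjt U = M" if U: "unitary U" for U
  proof -
    have "M = (\<integral>R. (U ** R) ** cjt (U ** R :: 'a^'k^'m) \<partial>gaussian v)"
      unfolding M_def using U v by (subst integral_mult_left_invariant) (auto simp: unitary_def)
    also have "\<dots> = (\<integral>R. (U ** (R ** cjt (R :: 'a^'k^'m))) ** cjt U \<partial>gaussian v)"
      by (simp add: cjt_mult matrix_mul_assoc)
    also have "\<dots> = U ** M ** cjt U"
      unfolding M_def using int
      by (subst integral_bounded_linear[OF bounded_linear_matrix_mult_left])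
        (auto simp: integral_bounded_linear[OF bounded_linear_matrix_mult_right]
          intro: integrable_bounded_linear[OF bounded_linear_matrix_mult_right])
    finally show ?thesis ..
  qed
  then have "M = mat (trace M / of_nat CARD('m))" by (rule unitary_invariant_scalar)
  moreover have "trace M = of_real (\<integral>R. (norm (R :: 'a^'k^'m))\<^sup>2 \<partial>gaussian v)"
    unfolding M_def integral_bounded_linear[OF bounded_linear_trace int, symmetric] trace_self
    by (rule integral_bounded_linear[OF bounded_linear_of_real gaussian_norm_square(1)[OF v]])
  ultimately show "M = mat (of_real (real CARD('k) * real DIM('a) * v))"
    by (simp add: gaussian_norm_square(2)[OF v] mult_ac)
qed

definition alpha :: "real \<Rightarrow> 'd::finite itself \<Rightarrow> real" where
  "alpha v _ = (\<integral>G. polar G \<bullet> (G :: 'a^'d^'d) \<partial>gaussian v) / real CARD('d)"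

lemma norm_polar_le': "norm (polar (G :: 'a^'d^'d)) \<le> sqrt (real CARD('d)) * (1 + norm x)"
proof -
  have "sqrt (real CARD('d)) * 1 \<le> sqrt (real CARD('d)) * (1 + norm x)"
    by (intro mult_left_mono) auto
  then show ?thesis using norm_polar_le[of G] by linarith
qed

lemma polar_moment:
  assumes v: "v > 0"
  shows "integrable (gaussian v) (\<lambda>G :: 'a^'d^'d. polar G ** cjt G)"
    and "(\<integral>G. polar G ** cjt (G :: 'a^'d^'d) \<partial>gaussian v) = alpha v TYPE('d) *\<^sub>R mat 1"
proof -
  show int: "integrable (gaussian v) (\<lambda>G :: 'a^'d^'d. polar G ** cjt G)"
    by (rule integrable_gaussian_quadratic[OF v, of _ _ "sqrt (real CARD('d))" 1]) (auto intro: norm_polar_le')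
  define M where "M = (\<integral>G. polar G ** cjt (G :: 'a^'d^'d) \<partial>gaussian v)"
  have "U ** M ** cjt U = M" if U: "unitary U" for U
  proof -
    have "M = (\<integral>G. polar (U ** G) ** cjt (U ** G :: 'a^'d^'d) \<partial>gaussian v)"
      unfolding M_def using U v by (subst integral_mult_left_invariant) (auto simp: unitary_def)
    also have "\<dots> = (\<integral>G. (U ** (polar G ** cjt (G :: 'a^'d^'d))) ** cjt U \<partial>gaussian v)"
      by (simp add: cjt_mult matrix_mul_assoc polar_mult_left[OF U])
    also have "\<dots> = U ** M ** cjt U"
      unfolding M_def using int
      by (subst integral_bounded_linear[OF bounded_linear_matrix_mult_left])
        (auto simp: integral_bounded_linear[OF bounded_linear_matrix_mult_right]
          intro: integrable_bounded_linear[OF bounded_linear_matrix_mult_right])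
    finally show ?thesis ..
  qed
  then have "M = mat (trace M / of_nat CARD('d))" by (rule unitary_invariant_scalar)
  moreover have "trace M = of_real (\<integral>G. polar G \<bullet> (G :: 'a^'d^'d) \<partial>gaussian v)"
  proof -
    have "integrable (gaussian v) (\<lambda>G :: 'a^'d^'d. re (trace (polar G ** cjt G)))"
      unfolding re_def by (intro integrable_inner_left integrable_bounded_linear[OF bounded_linear_trace int])
    then have "integrable (gaussian v) (\<lambda>G :: 'a^'d^'d. polar G \<bullet> G)" by (simp add: trace_polar)
    then show ?thesis
      unfolding M_def integral_bounded_linear[OF bounded_linear_trace int, symmetric] trace_polar
      by (rule integral_bounded_linear[OF bounded_linear_of_real])
  qed
  ultimately have "M = mat (of_real (alpha v TYPE('d)))" by (simp add: alpha_def)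
  then show "M = alpha v TYPE('d) *\<^sub>R mat 1" by (simp add: vec_eq_iff mat_def of_real_def)
qed

text \<open>The reflection \<open>Q = 2 X\<^sup>*X - I\<close> fixes \<open>XR\<close>, so averaging over it replaces \<open>R\<close> by its part \<open>X\<^sup>*XR\<close>
  in the row space of \<open>X\<close>.\<close>

lemma polar_cross_moment:
  fixes X :: "'a^'m^'d"
  assumes v: "v > 0" and X: "X ** cjt X = mat 1"
  shows "integrable (gaussian v) (\<lambda>R. polar (X ** R) ** cjt R)"
    and "(\<integral>R. polar (X ** R) ** cjt R \<partial>gaussian v) = alpha v TYPE('d) *\<^sub>R X"
proof -
  show int: "integrable (gaussian v) (\<lambda>R. polar (X ** R) ** cjt R)"
    by (rule integrable_gaussian_quadratic[OF v, of _ _ "sqrt (real CARD('d))" 1]) (auto intro: norm_polar_le')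
  define M where "M = (\<integral>R. polar (X ** R) ** cjt R \<partial>gaussian v)"
  define Q where "Q = 2 *\<^sub>R (cjt X ** X) - mat 1"
  have XQ: "X ** Q = X"
  proof -
    have "X ** Q = 2 *\<^sub>R X - X"
      by (simp only: Q_def matrix_diff_ldistrib matrix_scaleR_right matrix_mul_assoc X matrix_mul_lid matrix_mul_rid)
    then show ?thesis by (simp only: scaleR_2 add_diff_cancel)
  qed
  have cQ: "cjt Q = Q" by (simp add: Q_def cjt_diff cjt_scaleR cjt_mult)
  have "Q ** Q = 2 *\<^sub>R (cjt X ** (X ** Q)) - Q"
    by (simp add: Q_def matrix_diff_rdistrib matrix_scaleR_left matrix_mul_assoc)
  then have QQ: "Q ** cjt Q = mat 1" unfolding XQ cQ by (simp add: Q_def)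
  have "M = (\<integral>R. polar (X ** (Q ** R)) ** cjt (Q ** R) \<partial>gaussian v)"
    unfolding M_def using QQ v by (subst integral_mult_left_invariant) auto
  also have "\<dots> = (\<integral>R. (polar (X ** R) ** cjt R) ** Q \<partial>gaussian v)"
    by (simp add: cjt_mult cQ matrix_mul_assoc XQ)
  also have "\<dots> = M ** Q"
    unfolding M_def by (rule integral_bounded_linear[OF bounded_linear_matrix_mult_left int])
  finally have "M = 2 *\<^sub>R (M ** cjt X ** X) - M"
    by (simp only: Q_def matrix_diff_ldistrib matrix_scaleR_right matrix_mul_assoc matrix_mul_rid)
  then have "M = M ** cjt X ** X" by (rule eq_reflectionD)
  also have "M ** cjt X = (\<integral>R. polar (X ** R) ** cjt (X ** R) \<partial>gaussian v)"
    unfolding M_def integral_bounded_linear[OF bounded_linear_matrix_mult_left int, symmetric]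
    by (simp only: cjt_mult matrix_mul_assoc)
  also have "\<dots> = (\<integral>G. polar G ** cjt G \<partial>gaussian v)"
    by (rule integral_mult_left_invariant[OF v X, of "\<lambda>G. polar G ** cjt G"]) measurable
  also have "\<dots> = alpha v TYPE('d) *\<^sub>R mat 1" by (rule polar_moment(2)[OF v])
  finally show "M = alpha v TYPE('d) *\<^sub>R X" by (simp add: matrix_scaleR_left)
qed

end

section \<open>Rounding\<close>

lemma sum_UNIV_prod: "(\<Sum>p\<in>UNIV. f p) = (\<Sum>i\<in>UNIV. \<Sum>a\<in>UNIV. f (i :: 'n::finite, a :: 'd::finite))"
  by (simp add: sum.cartesian_product)

definition stack :: "('n::finite \<Rightarrow> 'a^'k^'d::finite) \<Rightarrow> 'a^'k^('n \<times> 'd)" where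
  "stack S = (\<chi> p. S (fst p) $ snd p)"

lemma trace_scaleR: "trace (r *\<^sub>R A) = r *\<^sub>R trace (A :: 'a::real_algebra_1^'n^'n)"
  by (simp add: trace_def scaleR_sum_right)

context star_field
begin

lemma trace_mult_cjt: "trace (A ** cjt B) = (\<Sum>p\<in>UNIV. \<Sum>c\<in>UNIV. A $ p $ c * cj (B $ p $ c))"
  by (simp add: trace_def matrix_matrix_mult_def cjt_def)

definition block_form :: "'a^('n::finite \<times> 'd::finite)^('n \<times> 'd) \<Rightarrow> ('n \<Rightarrow> 'a^'k^'d) \<Rightarrow> ('n \<Rightarrow> 'a^'k^'d) \<Rightarrow> 'a" where
  "block_form C S T = (\<Sum>i\<in>UNIV. \<Sum>j\<in>UNIV. trace (cjt (block C i j) ** S i ** cjt (T j)))"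

text \<open>For Hermitian \<open>C\<close> the conjugate transpose of block (i, j) is block (j, i),
  so the double sum over blocks is an ordinary product with the stacked matrices.\<close>

lemma block_form_stack:
  assumes C: "cjt C = C"
  shows "block_form C S T = trace (C ** stack S ** cjt (stack T))"
proof -
  have Cs: "cj (C $ p $ q) = C $ q $ p" for p q
    using arg_cong[OF C, of "\<lambda>M. M $ q $ p"] by (simp add: cjt_def)
  have CS: "(C ** stack S) $ (j, a) $ c = (\<Sum>i\<in>UNIV. (cjt (block C i j) ** S i) $ a $ c)" for j a c
    by (simp add: matrix_matrix_mult_def sum_UNIV_prod stack_def cjt_def block_def Cs)
  have "trace (C ** stack S ** cjt (stack T)) =
      (\<Sum>j\<in>UNIV. \<Sum>a\<in>UNIV. \<Sum>c\<in>UNIV. (C ** stack S) $ (j, a) $ c * cj (T j $ a $ c))"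
    unfolding trace_mult_cjt sum_UNIV_prod by (simp add: stack_def)
  also have "\<dots> = (\<Sum>j\<in>UNIV. \<Sum>a\<in>UNIV. \<Sum>c\<in>UNIV. \<Sum>i\<in>UNIV. (cjt (block C i j) ** S i) $ a $ c * cj (T j $ a $ c))"
    by (simp add: CS sum_distrib_right)
  also have "\<dots> = (\<Sum>j\<in>UNIV. \<Sum>a\<in>UNIV. \<Sum>i\<in>UNIV. \<Sum>c\<in>UNIV. (cjt (block C i j) ** S i) $ a $ c * cj (T j $ a $ c))"
    by (intro sum.cong refl) (rule sum.swap)
  also have "\<dots> = (\<Sum>j\<in>UNIV. \<Sum>i\<in>UNIV. \<Sum>a\<in>UNIV. \<Sum>c\<in>UNIV. (cjt (block C i j) ** S i) $ a $ c * cj (T j $ a $ c))"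
    by (intro sum.cong refl) (rule sum.swap)
  also have "\<dots> = (\<Sum>j\<in>UNIV. \<Sum>i\<in>UNIV. trace (cjt (block C i j) ** S i ** cjt (T j)))"
    by (simp only: trace_mult_cjt)
  also have "\<dots> = block_form C S T"
    unfolding block_form_def by (rule sum.swap)
  finally show ?thesis ..
qed

lemma block_form_cj:
  assumes C: "cjt C = C"
  shows "cj (block_form C S T) = block_form C T S"
proof -
  have "cj (block_form C S T) = trace (stack T ** cjt (stack S) ** C)"
    by (simp add: block_form_stack[OF C] trace_cjt[symmetric] cjt_mult C matrix_mul_assoc)
  also have "\<dots> = trace (C ** (stack T ** cjt (stack S)))" by (rule trace_mul_sym)
  finally show ?thesis by (simp add: block_form_stack[OF C] matrix_mul_assoc)
qed

text \<open>By cyclicity the trace is a sum, over the columns of the stacked matrix, of the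
  quadratic form of \<open>C\<close>.\<close>

lemma block_form_self_nonneg:
  assumes C: "cjt C = C"
    and psd: "\<And>x. 0 \<le> re (\<Sum>k\<in>UNIV. \<Sum>l\<in>UNIV. cj (x $ k) * C $ k $ l * x $ l)"
  shows "0 \<le> re (block_form C S S)"
proof -
  let ?S = "stack S"
  have "trace (C ** ?S ** cjt ?S) = trace (cjt ?S ** (C ** ?S))" by (rule trace_mul_sym)
  also have "\<dots> = (\<Sum>c\<in>UNIV. \<Sum>k\<in>UNIV. \<Sum>l\<in>UNIV. cj (?S $ k $ c) * C $ k $ l * ?S $ l $ c)"
    by (simp add: trace_def matrix_matrix_mult_def cjt_def sum_distrib_left mult.assoc)
  finally have "re (block_form C S S) = (\<Sum>c\<in>UNIV. re (\<Sum>k\<in>UNIV. \<Sum>l\<in>UNIV. cj (?S $ k $ c) * C $ k $ l * ?S $ l $ c))"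
    by (simp add: block_form_stack[OF C] re_sum)
  also have "\<dots> \<ge> 0"
  proof (rule sum_nonneg)
    fix c
    show "0 \<le> re (\<Sum>k\<in>UNIV. \<Sum>l\<in>UNIV. cj (?S $ k $ c) * C $ k $ l * ?S $ l $ c)"
      using psd[of "\<chi> k. ?S $ k $ c"] by simp
  qed
  finally show ?thesis .
qed

lemma block_form_diff:
  assumes C: "cjt C = C"
  shows "re (block_form C (\<lambda>i. S i - r *\<^sub>R T i) (\<lambda>i. S i - r *\<^sub>R T i)) =
    re (block_form C S S) - 2 * r * re (block_form C S T) + r\<^sup>2 * re (block_form C T T)"
proof -
  have "block_form C (\<lambda>i. S i - r *\<^sub>R T i) (\<lambda>i. S i - r *\<^sub>R T i) =
     block_form C S S - r *\<^sub>R block_form C S T - r *\<^sub>R block_form C T S + r\<^sup>2 *\<^sub>R block_form C T T"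
    by (simp add: block_form_def cjt_diff cjt_scaleR matrix_diff_ldistrib matrix_diff_rdistrib matrix_scaleR_left
      matrix_scaleR_right trace_sub trace_scaleR sum_subtractf scaleR_sum_right[symmetric] scaleR_diff_right power2_eq_square)
  \<comment> \<open>The two mixed terms are conjugate, hence the factor 2 in the expansion.\<close>
  moreover have "re (block_form C T S) = re (block_form C S T)"
    using re_cj[of "block_form C S T"] by (simp add: block_form_cj[OF C])
  ultimately show ?thesis by (simp add: re_add re_diff re_scaleR)
qed

context
  fixes C :: "'a^('n::finite \<times> 'd::finite)^('n \<times> 'd)" and X :: "'n \<Rightarrow> 'a^('n \<times> 'd)^'d" and v :: real
  assumes C: "cjt C = C"
    and psd: "\<And>x. 0 \<le> re (\<Sum>k\<in>UNIV. \<Sum>l\<in>UNIV. cj (x $ k) * C $ k $ l * x $ l)"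
    and X: "\<And>i. X i ** cjt (X i) = mat 1"
    and v_def: "v = 1 / (real CARD('d) * real DIM('a))"
begin

lemma v_pos: "v > 0"
  by (simp add: v_def)

lemma integrable_block_form:
  assumes "\<And>i j. integrable M (\<lambda>x. S x i ** cjt (T x j))"
  shows "integrable M (\<lambda>x. block_form C (S x) (T x))"
    and "(\<integral>x. block_form C (S x) (T x) \<partial>M) =
      (\<Sum>i\<in>UNIV. \<Sum>j\<in>UNIV. trace (cjt (block C i j) ** (\<integral>x. S x i ** cjt (T x j) \<partial>M)))"
proof -
  have bl: "bounded_linear (\<lambda>A. trace (cjt (block C i j) ** A))" for i j
    using bounded_linear_compose[OF bounded_linear_trace bounded_linear_matrix_mult_right] .
  have eq: "block_form C (S x) (T x) = (\<Sum>i\<in>UNIV. \<Sum>j\<in>UNIV. trace (cjt (block C i j) ** (S x i ** cjt (T x j))))" for x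
    by (simp add: block_form_def matrix_mul_assoc)
  have int: "integrable M (\<lambda>x. trace (cjt (block C i j) ** (S x i ** cjt (T x j))))" for i j
    by (rule integrable_bounded_linear[OF bl assms])
  show "integrable M (\<lambda>x. block_form C (S x) (T x))"
    unfolding eq by (intro Bochner_Integration.integrable_sum int)
  show "(\<integral>x. block_form C (S x) (T x) \<partial>M) =
      (\<Sum>i\<in>UNIV. \<Sum>j\<in>UNIV. trace (cjt (block C i j) ** (\<integral>x. S x i ** cjt (T x j) \<partial>M)))"
    unfolding eq by (simp add: int integral_bounded_linear[OF bl assms])
qed

lemma moment_polar_gaussian:
  shows "integrable (gaussian v) (\<lambda>R. polar (X i ** R) ** cjt (X j ** R))"
    and "(\<integral>R. polar (X i ** R) ** cjt (X j ** R) \<partial>gaussian v) = alpha v TYPE('d) *\<^sub>R (X i ** cjt (X j))"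
proof -
  note int = polar_cross_moment(1)[OF v_pos X, of i]
  have eq: "polar (X i ** R) ** cjt (X j ** R) = (polar (X i ** R) ** cjt R) ** cjt (X j)" for R
    by (simp add: cjt_mult matrix_mul_assoc)
  show "integrable (gaussian v) (\<lambda>R. polar (X i ** R) ** cjt (X j ** R))"
    unfolding eq by (rule integrable_bounded_linear[OF bounded_linear_matrix_mult_left int])
  show "(\<integral>R. polar (X i ** R) ** cjt (X j ** R) \<partial>gaussian v) = alpha v TYPE('d) *\<^sub>R (X i ** cjt (X j))"
    unfolding eq integral_bounded_linear[OF bounded_linear_matrix_mult_left int] polar_cross_moment(2)[OF v_pos X]
    by (rule matrix_scaleR_left)
qed

lemma moment_gaussian_gaussian:
  shows "integrable (gaussian v) (\<lambda>R :: 'a^'d^('n \<times> 'd). (X i ** R) ** cjt (X j ** R))"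
    and "(\<integral>R. (X i ** R) ** cjt (X j ** (R :: 'a^'d^('n \<times> 'd))) \<partial>gaussian v) = X i ** cjt (X j)"
proof -
  note int = gaussian_covariance(1)[OF v_pos, where 'k = 'd and 'm = "'n \<times> 'd"]
  have eq: "(X i ** R) ** cjt (X j ** R) = X i ** (R ** cjt R) ** cjt (X j)" for R :: "'a^'d^('n \<times> 'd)"
    by (simp add: cjt_mult matrix_mul_assoc)
  note int' = integrable_bounded_linear[OF bounded_linear_matrix_mult_right int, of "X i"]
  show "integrable (gaussian v) (\<lambda>R :: 'a^'d^('n \<times> 'd). (X i ** R) ** cjt (X j ** R))"
    unfolding eq by (rule integrable_bounded_linear[OF bounded_linear_matrix_mult_left int'])
  \<comment> \<open>This is where the value of \<open>v\<close> matters: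
    \<open>CARD('d) * DIM('a) * v = 1\<close>.\<close>
  have "(\<integral>R. R ** cjt (R :: 'a^'d^('n \<times> 'd)) \<partial>gaussian v) = mat 1"
    unfolding gaussian_covariance(2)[OF v_pos] by (simp add: v_def)
  then show "(\<integral>R. (X i ** R) ** cjt (X j ** (R :: 'a^'d^('n \<times> 'd))) \<partial>gaussian v) = X i ** cjt (X j)"
    unfolding eq integral_bounded_linear[OF bounded_linear_matrix_mult_left int']
      integral_bounded_linear[OF bounded_linear_matrix_mult_right int] by simp
qed

lemma integrable_polar_polar:
  "integrable (gaussian v) (\<lambda>R. polar (X i ** R) ** cjt (polar (X j ** R)))"
  by (rule integrable_gaussian_quadratic[OF v_pos, of _ _ "sqrt (real CARD('d))" "sqrt (real CARD('d))"])
    (auto intro: norm_polar_le')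

text \<open>The self-conjugacy claim serves the complex statement, whose order compares only numbers
  with equal imaginary parts.\<close>

lemma rounding_gaussian:
  shows "(alpha v TYPE('d))\<^sup>2 * re (block_form C X X)
     \<le> re (\<integral>R. block_form C (\<lambda>i. polar (X i ** R)) (\<lambda>i. polar (X i ** R)) \<partial>gaussian v)" (is ?ineq)
    and "cj (\<integral>R. block_form C (\<lambda>i. polar (X i ** R)) (\<lambda>i. polar (X i ** R)) \<partial>gaussian v)
     = (\<integral>R. block_form C (\<lambda>i. polar (X i ** R)) (\<lambda>i. polar (X i ** R)) \<partial>gaussian v)" (is ?real)
proof -
  let ?V = "\<lambda>R i. polar (X i ** R)" and ?Z = "\<lambda>R i. X i ** R" and ?\<alpha> = "alpha v TYPE('d)"
  let ?N = "gaussian v :: ('a^'d^('n \<times> 'd)) measure"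
  have blre: "bounded_linear re"
    using linear_re by (simp add: linear_conv_bounded_linear)
  have blcj: "bounded_linear cj"
    unfolding linear_conv_bounded_linear[symmetric] by (intro linearI) (auto simp: cj_add cj_scaleR)
  note VV = integrable_block_form[of ?N ?V ?V, OF integrable_polar_polar]
    and VZ = integrable_block_form[of ?N ?V ?Z, OF moment_polar_gaussian(1)]
    and ZZ = integrable_block_form[of ?N ?Z ?Z, OF moment_gaussian_gaussian(1)]
  have iVZ: "(\<integral>R. block_form C (?V R) (?Z R) \<partial>?N) = ?\<alpha> *\<^sub>R block_form C X X"
    unfolding VZ(2) moment_polar_gaussian(2)
    by (simp add: block_form_def matrix_scaleR_right trace_scaleR scaleR_sum_right matrix_mul_assoc)
  have iZZ: "(\<integral>R. block_form C (?Z R) (?Z R) \<partial>?N) = block_form C X X"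
    unfolding ZZ(2) moment_gaussian_gaussian(2) by (simp add: block_form_def matrix_mul_assoc)
  \<comment> \<open>Writing q for the objective at \<open>X\<close>, the mixed expectation is
    \<alpha> q and that of the square of \<open>Z\<close> is q, and 2 \<alpha> (\<alpha> q) -
    \<alpha>^2 q = \<alpha>^2 q.\<close>
  have "?\<alpha>\<^sup>2 * re (block_form C X X) =
      2 * ?\<alpha> * re (\<integral>R. block_form C (?V R) (?Z R) \<partial>?N) - ?\<alpha>\<^sup>2 * re (\<integral>R. block_form C (?Z R) (?Z R) \<partial>?N)"
    unfolding iVZ iZZ by (simp add: re_scaleR power2_eq_square)
  also have "\<dots> = (\<integral>R. 2 * ?\<alpha> * re (block_form C (?V R) (?Z R)) - ?\<alpha>\<^sup>2 * re (block_form C (?Z R) (?Z R)) \<partial>?N)"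
    using integrable_bounded_linear[OF blre VZ(1)] integrable_bounded_linear[OF blre ZZ(1)]
    by (simp add: integral_bounded_linear[OF blre VZ(1)] integral_bounded_linear[OF blre ZZ(1)])
  also have "\<dots> \<le> (\<integral>R. re (block_form C (?V R) (?V R)) \<partial>?N)"
  proof (rule integral_mono)
    show "integrable ?N (\<lambda>R. 2 * ?\<alpha> * re (block_form C (?V R) (?Z R)) - ?\<alpha>\<^sup>2 * re (block_form C (?Z R) (?Z R)))"
      using integrable_bounded_linear[OF blre VZ(1)] integrable_bounded_linear[OF blre ZZ(1)]
      by (intro Bochner_Integration.integrable_diff integrable_mult_right) auto
    show "integrable ?N (\<lambda>R. re (block_form C (?V R) (?V R)))"
      by (rule integrable_bounded_linear[OF blre VV(1)])
    fix R
    have "0 \<le> re (block_form C (\<lambda>i. ?V R i - ?\<alpha> *\<^sub>R ?Z R i) (\<lambda>i. ?V R i - ?\<alpha> *\<^sub>R ?Z R i))"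
      by (rule block_form_self_nonneg[OF C psd])
    then show "2 * ?\<alpha> * re (block_form C (?V R) (?Z R)) - ?\<alpha>\<^sup>2 * re (block_form C (?Z R) (?Z R))
        \<le> re (block_form C (?V R) (?V R))"
      unfolding block_form_diff[OF C] by linarith
  qed
  also have "\<dots> = re (\<integral>R. block_form C (?V R) (?V R) \<partial>?N)"
    by (rule integral_bounded_linear[OF blre VV(1)])
  finally show ?ineq .
  show ?real
    unfolding integral_bounded_linear[OF blcj VV(1), symmetric] block_form_cj[OF C] ..
qed

text \<open>The samples enter through maps \<open>\<phi>\<close> and \<open>\<psi>\<close> with
  Gaussian law, so that product measures over real or complex entries both fit. The finitely many
  matrices \<open>X i ** \<phi> g\<close> are almost surely all nonsingular, and there
  \<open>proj\<close> agrees with \<open>polar\<close>.\<close>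

lemma rounding_completion:
  assumes \<phi> [measurable]: "\<phi> \<in> M \<rightarrow>\<^sub>M borel" and law: "distr M borel \<phi> = (gaussian v :: ('a^'d^('n \<times> 'd)) measure)"
    and \<psi> [measurable]: "\<psi> \<in> L \<rightarrow>\<^sub>M borel" and law': "distr L borel \<psi> = (gaussian v :: ('a^'d^'d) measure)"
  defines "I \<equiv> \<integral>g. block_form C (\<lambda>i. proj (X i ** \<phi> g)) (\<lambda>i. proj (X i ** \<phi> g)) \<partial>completion M"
    and "\<alpha> \<equiv> \<integral>g. (1 / real CARD('d)) * sum_mset (sing_vals (\<psi> g)) \<partial>completion L"
  shows "\<alpha>\<^sup>2 * re (block_form C X X) \<le> re I" and "cj I = I"
proof -
  let ?V = "\<lambda>R i. polar (X i ** R)"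
  have "AE R in gaussian v. det (X i ** R :: 'a^'d^'d) \<noteq> 0" for i
    using AE_gaussian_det_nonzero[of v, where 'a='a and 'n='d]
    unfolding gaussian_distr_mult_left[OF v_pos X, of i, symmetric]
    by (rule AE_distrD[where P = "\<lambda>G. det G \<noteq> 0", rotated]) measurable
  then have "AE R in gaussian v. \<forall>i. det (X i ** R :: 'a^'d^'d) \<noteq> 0"
    unfolding AE_all_countable ..
  then have "AE g in M. \<forall>i. det (X i ** \<phi> g) \<noteq> 0"
    unfolding law[symmetric] by (rule AE_distrD[OF \<phi>, where P = "\<lambda>R. \<forall>i. det (X i ** R) \<noteq> 0"])
  then have ae: "AE g in M. block_form C (\<lambda>i. proj (X i ** \<phi> g)) (\<lambda>i. proj (X i ** \<phi> g)) =
      block_form C (?V (\<phi> g)) (?V (\<phi> g))"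
    by eventually_elim (simp add: polar_def)
  have "integrable (gaussian v) (\<lambda>R. block_form C (?V R) (?V R))"
    by (rule integrable_block_form(1)[OF integrable_polar_polar])
  then have meas: "(\<lambda>R. block_form C (?V R) (?V R)) \<in> borel_measurable borel"
    using borel_measurable_integrable measurable_cong_sets[OF sets_gaussian refl] by blast
  have "I = (\<integral>g. block_form C (?V (\<phi> g)) (?V (\<phi> g)) \<partial>M)"
    unfolding I_def using measurable_compose[OF \<phi> meas] ae by (rule integral_completion_AE)
  also have "\<dots> = (\<integral>R. block_form C (?V R) (?V R) \<partial>gaussian v)"
    unfolding law[symmetric] by (rule integral_distr[OF \<phi> meas, symmetric])
  finally have I: "I = (\<integral>R. block_form C (?V R) (?V R) \<partial>gaussian v)" .
  have "AE g in L. det (\<psi> g) \<noteq> 0"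
    using AE_gaussian_det_nonzero[of v, where 'a='a and 'n='d] unfolding law'[symmetric]
    by (rule AE_distrD[OF \<psi>, where P = "\<lambda>G. det G \<noteq> 0"])
  then have ae': "AE g in L. (1 / real CARD('d)) * sum_mset (sing_vals (\<psi> g)) = (1 / real CARD('d)) * (polar (\<psi> g) \<bullet> \<psi> g)"
    by eventually_elim (simp add: sum_sing_vals)
  have "\<alpha> = (\<integral>g. (1 / real CARD('d)) * (polar (\<psi> g) \<bullet> \<psi> g) \<partial>L)"
    unfolding \<alpha>_def by (rule integral_completion_AE[OF _ ae']) measurable
  also have "\<dots> = (\<integral>G. (1 / real CARD('d)) * (polar G \<bullet> (G :: 'a^'d^'d)) \<partial>gaussian v)"
    unfolding law'[symmetric]
    by (rule integral_distr[OF \<psi>, where f = "\<lambda>G. (1 / real CARD('d)) * (polar G \<bullet> G)", symmetric]) measurable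
  also have "\<dots> = alpha v TYPE('d)" by (simp add: alpha_def)
  finally have a: "\<alpha> = alpha v TYPE('d)" .
  show "\<alpha>\<^sup>2 * re (block_form C X X) \<le> re I" unfolding I a by (rule rounding_gaussian(1))
  show "cj I = I" unfolding I by (rule rounding_gaussian(2))
qed

end

end

section \<open>Coordinate measures and specialisation to the two fields\<close>

lemma distr_rmat:
  assumes "v > 0"
  shows "rmat \<in> (gauss_R v :: ('m::finite \<times> 'd::finite \<Rightarrow> real) measure) \<rightarrow>\<^sub>M borel"
    and "distr (gauss_R v :: ('m \<times> 'd \<Rightarrow> real) measure) borel rmat = gaussian v"
proof -
  define b :: "'m \<times> 'd \<Rightarrow> real^'d^'m" where "b = (\<lambda>(k, a). axis k (axis a 1))"
  have b: "bij_betw b UNIV Basis"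
    unfolding b_def by (auto simp: bij_betw_def inj_on_def axis_eq_axis Basis_vec_def image_iff)
  have r: "rmat = (\<lambda>g. \<Sum>i\<in>UNIV. g i *\<^sub>R b i)"
  proof (intro ext)
    fix g :: "'m \<times> 'd \<Rightarrow> real"
    have "(\<Sum>i\<in>UNIV. g i *\<^sub>R b i) $ k $ a = g (k, a)" for k a
    proof -
      have "(\<Sum>i\<in>UNIV. g i *\<^sub>R b i) $ k $ a = (\<Sum>i\<in>UNIV. if i = (k, a) then g (k, a) else 0)"
        unfolding sum_component
      proof (rule sum.cong)
        fix i :: "'m \<times> 'd"
        show "(g i *\<^sub>R b i) $ k $ a = (if i = (k, a) then g (k, a) else 0)"
          by (cases i, cases "fst i = k"; cases "snd i = a") (simp_all add: b_def axis_def)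
      qed simp
      then show ?thesis by simp
    qed
    then show "rmat g = (\<Sum>i\<in>UNIV. g i *\<^sub>R b i)" by (simp add: rmat_def vec_eq_iff)
  qed
  show "rmat \<in> (gauss_R v :: ('m \<times> 'd \<Rightarrow> real) measure) \<rightarrow>\<^sub>M borel"
    unfolding r gauss_R_def by measurable
  show "distr (gauss_R v :: ('m \<times> 'd \<Rightarrow> real) measure) borel rmat = gaussian v"
    unfolding r gauss_R_def by (rule distr_PiM_normal_Basis[OF assms finite b])
qed

lemma distr_cmat:
  assumes "v > 0"
  shows "cmat \<in> (gauss_R v :: ('m::finite \<times> 'd::finite \<times> bool \<Rightarrow> real) measure) \<rightarrow>\<^sub>M borel"
    and "distr (gauss_R v :: ('m \<times> 'd \<times> bool \<Rightarrow> real) measure) borel cmat = gaussian v"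
proof -
  \<comment> \<open>The flag \<open>True\<close> marks the real part and \<open>False\<close> the
    imaginary part, matching the basis 1, i of the complex numbers.\<close>
  define b :: "'m \<times> 'd \<times> bool \<Rightarrow> complex^'d^'m"
    where "b = (\<lambda>(k, a, c). axis k (axis a (if c then 1 else \<i>)))"
  have b: "bij_betw b UNIV Basis"
    unfolding bij_betw_def
  proof
    show "inj b" by (auto simp: b_def inj_def axis_eq_axis split: if_splits)
    show "range b = Basis"
      by (force simp: b_def Basis_vec_def Basis_complex_def image_iff)
  qed
  have r: "cmat = (\<lambda>g. \<Sum>i\<in>UNIV. g i *\<^sub>R b i)"
  proof (intro ext)
    fix g :: "'m \<times> 'd \<times> bool \<Rightarrow> real"
    have "(\<Sum>i\<in>UNIV. g i *\<^sub>R b i) $ k $ a = Complex (g (k, a, True)) (g (k, a, False))" for k a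
    proof -
      have "(\<Sum>i\<in>UNIV. g i *\<^sub>R b i) $ k $ a =
          (\<Sum>i\<in>UNIV. (if i = (k, a, True) then complex_of_real (g (k, a, True)) else 0) +
             (if i = (k, a, False) then \<i> * complex_of_real (g (k, a, False)) else 0))"
        unfolding sum_component
      proof (rule sum.cong)
        fix i :: "'m \<times> 'd \<times> bool"
        obtain k' a' c where i: "i = (k', a', c)" by (cases i)
        show "(g i *\<^sub>R b i) $ k $ a = (if i = (k, a, True) then complex_of_real (g (k, a, True)) else 0) +
             (if i = (k, a, False) then \<i> * complex_of_real (g (k, a, False)) else 0)"
          by (cases "k' = k"; cases "a' = a"; cases c) (simp_all add: i b_def axis_def complex_eq_iff)
      qed simp
      then show ?thesis by (simp add: sum.distrib Complex_eq)
    qed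
    then show "cmat g = (\<Sum>i\<in>UNIV. g i *\<^sub>R b i)" by (simp add: cmat_def vec_eq_iff)
  qed
  show "cmat \<in> (gauss_R v :: ('m \<times> 'd \<times> bool \<Rightarrow> real) measure) \<rightarrow>\<^sub>M borel"
    unfolding r gauss_R_def by measurable
  show "distr (gauss_R v :: ('m \<times> 'd \<times> bool \<Rightarrow> real) measure) borel cmat = gaussian v"
    unfolding r gauss_R_def by (rule distr_PiM_normal_Basis[OF assms finite b])
qed

interpretation real: star_field "id :: real \<Rightarrow> real"
  by unfold_locales (simp_all add: power2_eq_square)

interpretation complex: star_field cnj
  by unfold_locales (simp_all only: complex_cnj_add complex_cnj_mult complex_cnj_cnj complex_norm_square mult.commute)

lemma real_star_field_simps:
  "real.re x = x" "real.cjt A = transpose A" "real.unitary U = orthogonal_matrix U"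
  "real.proj G = proj_O G" "real.sing_vals G = sing_vals_R G"
proof -
  show t: "real.cjt A = transpose A" for A :: "real^'q^'p" by (simp only: real.cjt_def transpose_def id_apply)
  show u: "real.unitary U = orthogonal_matrix U" for U :: "real^'p^'p"
    unfolding real.unitary_def orthogonal_matrix_def t ..
  show "real.re x = x" by (simp add: real.re_def)
  show "real.proj G = proj_O G" unfolding real.proj_def proj_O_def u ..
  show "real.sing_vals G = sing_vals_R G" unfolding real.sing_vals_def sing_vals_R_def u t of_real_eq_id id_apply vec_lambda_eta ..
qed

lemma complex_star_field_simps:
  "complex.re x = Re x" "complex.cjt A = cnj_transpose A" "complex.unitary U = unitary_matrix U"
  "complex.proj G' = proj_U G'" "complex.sing_vals G' = sing_vals_C G'"
proof -
  show t: "complex.cjt A = cnj_transpose A" for A :: "complex^'q^'p"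
    unfolding complex.cjt_def cnj_transpose_def ..
  show u: "complex.unitary U = unitary_matrix U" for U :: "complex^'p^'p"
    unfolding complex.unitary_def unitary_matrix_def t ..
  show "complex.re x = Re x" by (simp add: complex.re_def)
  show "complex.proj G' = proj_U G'" unfolding complex.proj_def proj_U_def u ..
  show "complex.sing_vals G' = sing_vals_C G'" unfolding complex.sing_vals_def sing_vals_C_def u t ..
qed

theorem theorem2:
  fixes C :: "real^('n::finite \<times> 'd::finite)^('n \<times> 'd)"
    and X :: "'n \<Rightarrow> real^('n \<times> 'd)^'d"
    and Ch :: "complex^('n \<times> 'd)^('n \<times> 'd)"
    and Y :: "'n \<Rightarrow> complex^('n \<times> 'd)^'d"
  assumes C_sym: "transpose C = C"
    and C_psd: "\<forall>x. 0 \<le> x \<bullet> (C *v x)"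
    and X_orth: "\<forall>i. X i ** transpose (X i) = mat 1"
    and Ch_herm: "cnj_transpose Ch = Ch"
    and Ch_psd: "\<forall>x. 0 \<le> Re (\<Sum>k\<in>UNIV. \<Sum>l\<in>UNIV. cnj (x $ k) * Ch $ k $ l * x $ l)"
    and Y_orth: "\<forall>i. Y i ** cnj_transpose (Y i) = mat 1"
  shows "(\<integral>g. (\<Sum>i\<in>UNIV. \<Sum>j\<in>UNIV.
            trace (transpose (block C i j) ** proj_O (X i ** rmat g)
                   ** transpose (proj_O (X j ** rmat g))))
          \<partial>completion (gauss_R (1 / real CARD('d))))
       \<ge> (alpha_R TYPE('d))\<^sup>2 *
          (\<Sum>i\<in>UNIV. \<Sum>j\<in>UNIV. trace (transpose (block C i j) ** X i ** transpose (X j)))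
     \<and> (\<integral>g. (\<Sum>i\<in>UNIV. \<Sum>j\<in>UNIV.
            trace (cnj_transpose (block Ch i j) ** proj_U (Y i ** cmat g)
                   ** cnj_transpose (proj_U (Y j ** cmat g))))
          \<partial>completion (gauss_R (1 / (2 * real CARD('d)))))
       \<ge> complex_of_real ((alpha_C TYPE('d))\<^sup>2) *
          (\<Sum>i\<in>UNIV. \<Sum>j\<in>UNIV. trace (cnj_transpose (block Ch i j) ** Y i ** cnj_transpose (Y j)))"
    (is "?real \<and> ?rhs \<le> ?lhs")
proof
  let ?v = "1 / real CARD('d)" and ?w = "1 / (2 * real CARD('d))"
  have v: "?v > 0" "?w > 0" by simp_all
  have dims: "?v = 1 / (real CARD('d) * real DIM(real))" "?w = 1 / (real CARD('d) * real DIM(complex))"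
    by simp_all
  have psd: "0 \<le> (\<Sum>k\<in>UNIV. \<Sum>l\<in>UNIV. x $ k * C $ k $ l * x $ l)" for x
    using C_psd[rule_format, of x]
    by (simp add: inner_vec_def matrix_vector_mult_def sum_distrib_left mult.assoc)
  \<comment> \<open>The underscores keep the algebraic hypotheses open until unfolding has put them
    into the vocabulary of the theorem.\<close>
  note r = real.rounding_completion(1)[where C = C and X = X and v = ?v,
      OF _ _ _ _ distr_rmat[OF v(1)] distr_rmat[OF v(1)],
      unfolded real_star_field_simps real.block_form_def id_apply, OF C_sym psd X_orth[rule_format] dims(1)]
  show ?real
    using r by (simp add: alpha_R_def)
  note c = complex.rounding_completion[where C = Ch and X = Y and v = ?w,
      OF _ _ _ _ distr_cmat[OF v(2)] distr_cmat[OF v(2)],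
      unfolded complex_star_field_simps complex.block_form_def, OF Ch_herm Ch_psd[rule_format] Y_orth[rule_format] dims(2)]
  \<comment> \<open>In the complex order \<open>w \<le> z\<close> includes equality of imaginary
    parts; self-conjugacy of both sides makes these zero.\<close>
  have le: "w \<le> z" if "Re w \<le> Re z" "cnj z = z" "cnj w = w" for w z
    using that by (simp add: less_eq_complex_def complex_eq_iff)
  show "?rhs \<le> ?lhs"
  proof (rule le)
    show "Re ?rhs \<le> Re ?lhs"
      using c(1) by (simp add: alpha_C_def)
    show "cnj ?lhs = ?lhs" using c(2) .
    show "cnj ?rhs = ?rhs"
      unfolding complex_cnj_mult complex_cnj_complex_of_real
        complex.block_form_cj[of Ch Y Y, unfolded complex.block_form_def complex_star_field_simps, OF Ch_herm] ..
  qed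
qed

end
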